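(* Let $q=2^n$ with $n\ge 3$, let $h$ be a positive integer with $\gcd(n,h)=1$, and let $\mathcal A\subset\mathrm{PG}(3,q)$, $G_h$, $\mathfrak s$ and $\mathcal O_0,\mathcal O_1,\mathcal O_2,\mathcal O_3$ be as defined in the context. Then $G_h$ has exactly five orbits on the planes of $\mathrm{PG}(3,q)$: (1) the $q+1$ osculating planes; (2) $\mathcal O_0^{\mathfrak s}$, of size $(q^3-q)/3$, consisting of the planes containing no point of $\mathcal A$; (3) $\mathcal O_1^{\mathfrak s}$, of size $(q^3-q)/2$, consisting of the non-osculating planes containing exactly one point of $\mathcal A$; (4) $\mathcal O_2^{\mathfrak s}$, of size $q^2+q$, consisting of the planes containing exactly two points of $\mathcal A$; (5) $\mathcal O_3^{\mathfrak s}$, of size $(q^3-q)/6$, consisting of the planes containing exactly three points of $\mathcal A$.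
   Context: Points of $\mathrm{PG}(3,q)$ have homogeneous coordinates $(X_1,X_2,X_3,X_4)$, written as column vectors when acted on by matrices; $U_i$ is the point with $1$ in position $i$ and $0$ elsewhere. $\mathcal A=\{P_t=(1,t,t^{2^h},t^{2^h+1})\mid t\in\mathbb F_q\}\cup\{U_4\}$. $G_h\simeq \mathrm{PGL}(2,q)$ is the group of projectivities of $\mathrm{PG}(3,q)$ stabilizing $\mathcal A$; its elements are represented by the matrices $$M_{a,b,c,d}=\begin{pmatrix} a^{2^h+1}&a^{2^h}b&ab^{2^h}&b^{2^h+1}\\ a^{2^h}c&a^{2^h}d&b^{2^h}c&b^{2^h}d\\ ac^{2^h}&bc^{2^h}&ad^{2^h}&bd^{2^h}\\ c^{2^h+1}&c^{2^h}d&cd^{2^h}&d^{2^h+1}\end{pmatrix},\quad a,b,c,d\in\mathbb F_q,\ ad+bc=1.$$ $\mathfrak s$ is the symplectic polarity of $\mathrm{PG}(3,q)$ defined by the alternating form $x_1y_4+x_2y_3+x_3y_2+x_4y_1$. The osculating planes are the $q+1$ planes $P^{\mathfrak s}$, $P\in\mathcal A$: $P_t^{\mathfrak s}: t^{2^h+1}X_1+t^{2^h}X_2+tX_3+X_4=0$ and $U_4^{\mathfrak s}:X_1=0$. For $i\in\{0,1,2,3\}$, $\mathcal O_i$ is the set of points of $\mathrm{PG}(3,q)\setminus\mathcal A$ lying on exactly $i$ osculating planes, and $\mathcal O_i^{\mathfrak s}=\{P^{\mathfrak s}\mid P\in\mathcal O_i\}$. *)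

theory Defs
  imports "HOL-Analysis.Cartesian_Space" "HOL-Algebra.Group_Action"
begin

text \<open>Points, lines and planes of \<open>PG(3,q)\<close> are the vector subspaces of \<open>'a ^ 4\<close> of
  dimension 1, 2 and 3, where \<open>'a\<close> is a field with \<open>q\<close> elements; incidence is inclusion.\<close>

definition pg_subspaces :: "('a::{field,finite} ^ 4) set set" where
  "pg_subspaces = {S. vec.subspace S}"

definition pg_points :: "('a::{field,finite} ^ 4) set set" where
  "pg_points = {S. vec.subspace S \<and> vec.dim S = 1}"

definition pg_planes :: "('a::{field,finite} ^ 4) set set" where
  "pg_planes = {S. vec.subspace S \<and> vec.dim S = 3}"

definition pt :: "'a::{field,finite} ^ 4 \<Rightarrow> ('a ^ 4) set" where
  "pt v = vec.span {v}"

text \<open>The action of an invertible matrix on all subspaces. It is restricted to subspaces so that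
  two matrices give the same projectivity precisely when they are proportional.\<close>

definition projectivity :: "'a::{field,finite} ^ 4 ^ 4 \<Rightarrow> ('a ^ 4) set \<Rightarrow> ('a ^ 4) set" where
  "projectivity M = (\<lambda>S \<in> pg_subspaces. (*v) M ` S)"

definition PGL4 :: "(('a::{field,finite} ^ 4) set \<Rightarrow> ('a ^ 4) set) monoid" where
  "PGL4 = (BijGroup pg_subspaces) \<lparr>carrier := {projectivity M | M. invertible M}\<rparr>"

definition arc_pt :: "nat \<Rightarrow> 'a::{field,finite} \<Rightarrow> ('a ^ 4) set" where
  "arc_pt h t = pt (vector [1, t, t ^ (2 ^ h), t ^ (2 ^ h + 1)])"

definition arc :: "nat \<Rightarrow> ('a::{field,finite} ^ 4) set set" where
  "arc h = range (arc_pt h) \<union> {pt (axis 4 1)}"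

definition arc_group :: "nat \<Rightarrow> (('a::{field,finite} ^ 4) set \<Rightarrow> ('a ^ 4) set) monoid" where
  "arc_group h = PGL4 \<lparr>carrier := stabilizer PGL4 (\<lambda>g X. g ` X) (arc h)\<rparr>"

text \<open>This form is alternating in characteristic 2 only, hence the absence of signs.\<close>

definition symp_form :: "'a::{field,finite} ^ 4 \<Rightarrow> 'a ^ 4 \<Rightarrow> 'a" where
  "symp_form x y = x $ 1 * y $ 4 + x $ 2 * y $ 3 + x $ 3 * y $ 2 + x $ 4 * y $ 1"

definition polar :: "('a::{field,finite} ^ 4) set \<Rightarrow> ('a ^ 4) set" where
  "polar S = {y. \<forall>x\<in>S. symp_form x y = 0}"

definition osculating_planes :: "nat \<Rightarrow> ('a::{field,finite} ^ 4) set set" where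
  "osculating_planes h = polar ` arc h"

definition osc_class :: "nat \<Rightarrow> nat \<Rightarrow> ('a::{field,finite} ^ 4) set set" where
  "osc_class h i =
     {P \<in> pg_points - arc h. card {\<pi> \<in> osculating_planes h. P \<subseteq> \<pi>} = i}"

definition arc_pts_on :: "nat \<Rightarrow> ('a::{field,finite} ^ 4) set \<Rightarrow> ('a ^ 4) set set" where
  "arc_pts_on h \<pi> = {P \<in> arc h. P \<subseteq> \<pi>}"

lemma vector_4_nth:
  "(vector [a, b, c, d] :: 'a::zero ^ 4) $ 1 = a"
  "(vector [a, b, c, d] :: 'a::zero ^ 4) $ 2 = b"
  "(vector [a, b, c, d] :: 'a::zero ^ 4) $ 3 = c"
  "(vector [a, b, c, d] :: 'a::zero ^ 4) $ 4 = d"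
  by (simp_all add: vector_def)

lemma polar_pt: "polar (pt v) = {y. symp_form v y = 0}"
proof -
  have "symp_form (c *s v) y = c * symp_form v y" for c y
    by (simp add: symp_form_def algebra_simps)
  then show ?thesis
    by (auto simp: polar_def pt_def vec.span_singleton dest: spec[of _ "1"])
qed

lemma polar_arc_pt:
  "polar (arc_pt h t) =
     {X. t ^ (2 ^ h + 1) * X $ 1 + t ^ (2 ^ h) * X $ 2 + t * X $ 3 + X $ 4 = 0}"
  unfolding arc_pt_def polar_pt symp_form_def vector_4_nth by (simp add: algebra_simps)

lemma polar_U4: "polar (pt (axis 4 1)) = {X. X $ 1 = 0}"
  unfolding polar_pt symp_form_def by (simp add: axis_def)

end

theory Submission
  imports Defs "HOL-Number_Theory.Residues"
begin

text \<open>Write \<open>s(x) = x ^ (2 ^ h)\<close>, a generator of the Galois group. A point of the space is a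
  \<open>2 \<times> 2\<close> matrix \<open>X\<close> up to scalars, on which \<open>g\<close> in \<open>SL(2,q)\<close> acts by
  \<open>X \<mapsto> s(g) X g\<^sup>T\<close>; the arc consists of the matrices \<open>s(z) z\<^sup>T\<close>, and the symplectic form
  is the polarisation of the determinant, so planes transform in the same way.

  A plane with a point on the arc can be moved to contain \<open>U\<^sub>4\<close>. Its equation then restricts
  to an affine equation \<open>b s(t) + c t + a = 0\<close>, whose number of roots is read off from the
  kernel of an additive map; this yields normal forms, and by double counting the sizes of the
  classes. Planes missing the arc are handled by counting instead: the stabiliser of such a plane in
  \<open>SL(2,q)\<close>, together with 0, is closed under addition, and each of its elements other than 0
  and 1 has determinant 1 and trace 1. So it has at most 3 elements, every orbit has at least
  \<open>(q\<^sup>3 - q) / 3\<close> elements, and that is the number of all such planes.\<close>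

text \<open>The group is the full stabiliser of the arc in PGL(4,q), and it is never identified with
  PGL(2,q). Transitivity only asks for enough group elements, and the determinant-one matrices
  supply them. Invariance of the classes must hold for every stabilising matrix, so it rests on
  intrinsic data: the number of arc points and, to separate the two kinds of planes with one arc
  point, the property \<open>tangential\<close>. Why the stabiliser of a plane missing the arc is so
  small: written additively, the fixed point equation still allows determinants to be taken, and
  these show that det g is fixed by \<open>s\<close>, hence 0 or 1. The value 0 with g nonzero would
  put an arc point on the plane. The same applied to g + 1 forces trace 1. Two elements of trace 1
  have a sum of trace 0, so only 1, g and g + 1 can occur. The bound 3 is the order of the
  multiplicative group of the field with four elements.\<close>

section \<open>Finite fields of even order\<close>

lemma field_power_card:
  fixes x :: "'a::{field,finite}"
  shows "x ^ CARD('a) = x"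
proof (cases "x = 0")
  case False
  have "\<Prod>(UNIV - {0::'a}) = (\<Prod>y\<in>UNIV - {0}. x * y)"
    by (rule prod.reindex_bij_witness[of _ "\<lambda>y. x * y" "\<lambda>y. y / x"]) (use False in auto)
  also have "\<dots> = x ^ (CARD('a) - 1) * \<Prod>(UNIV - {0})"
    by (simp add: prod.distrib)
  finally have "x ^ (CARD('a) - 1) = 1"
    by simp
  then show ?thesis
    using finite_UNIV_card_ge_0[where ?'a = 'a] by (metis finite mult.right_neutral power_eq_if less_numeral_extra(3))
qed simp

lemma field_char_2:
  assumes "CARD('a::{field,finite}) = 2 ^ n"
  shows "CHAR('a) = 2"
proof -
  have "prime CHAR('a)"
    using finite_imp_CHAR_pos[of] by (metis finite prime_CHAR_semidom)
  moreover have "CHAR('a) dvd 2 ^ n"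
    using CHAR_dvd_CARD[where ?'a = 'a] assms by simp
  ultimately show ?thesis
    by (metis prime_dvd_power primes_dvd_imp_eq two_is_prime_nat)
qed

text \<open>By Bezout, some multiple of \<open>h\<close> is one more than a multiple of
  \<open>n\<close>. The \<open>h\<close>-th and the \<open>n\<close>-th iterate of squaring both fix
  \<open>x\<close>, so squaring itself does.\<close>

lemma frobenius_power_fixed:
  fixes x :: "'a::{field,finite}"
  assumes "CARD('a) = 2 ^ n" and "h > 0" and "gcd n h = 1" and x: "x ^ (2 ^ h) = x"
  shows "x = 0 \<or> x = 1"
proof -
  have iter: "x ^ (2 ^ (k * m)) = x" if "x ^ (2 ^ m) = x" for k m
    by (induction k) (simp_all add: that power_add power_mult mult.commute)
  obtain a b where ab: "h * a = n * b + 1"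
    using bezout_nat[of h n] assms(2,3) by (auto simp: gcd.commute)
  have "x = x ^ (2 ^ (a * h))"
    by (simp add: iter x)
  also have "\<dots> = (x ^ (2 ^ (b * n)))\<^sup>2"
    using ab by (simp add: mult.commute power_mult[symmetric])
  also have "x ^ (2 ^ (b * n)) = x"
    using iter[of n b] field_power_card[of x] assms(1) by simp
  finally show ?thesis
    by (simp add: power2_eq_square)
qed

section \<open>Planes as polars of points\<close>

definition perp :: "'a::{field,finite} ^ 4 \<Rightarrow> ('a ^ 4) set" where
  "perp v = {y. symp_form v y = 0}"

text \<open>The plain image, without the restriction to subspaces built into
  \<open>projectivity\<close>, so that composition holds without side conditions.\<close>

definition mat_image :: "'a::{field,finite} ^ 4 ^ 4 \<Rightarrow> ('a ^ 4) set \<Rightarrow> ('a ^ 4) set" where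
  "mat_image M S = (*v) M ` S"

lemma polar_pt_perp: "polar (pt v) = perp v"
  by (simp add: polar_pt perp_def)

lemma vec4_eq_iff: "x = y \<longleftrightarrow> x $ 1 = y $ 1 \<and> x $ 2 = y $ 2 \<and> x $ 3 = y $ 3 \<and> x $ 4 = y $ 4"
  for x y :: "'a ^ 4"
  by (simp add: vec_eq_iff forall_4)

lemma symp_add: "symp_form x (y + z) = symp_form x y + symp_form x z"
  and symp_scale: "symp_form x (c *s y) = c * symp_form x y"
  and symp_scale_left: "symp_form (c *s x) y = c * symp_form x y"
  and symp_commute: "symp_form x y = symp_form y x"
  and symp_diff: "symp_form x (y - z) = symp_form x y - symp_form x z"
  by (simp_all add: symp_form_def algebra_simps)

lemma symp_nondegenerate:
  assumes "\<And>y. symp_form v y = symp_form w y"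
  shows "v = w"
  using assms[of "axis 1 1"] assms[of "axis 2 1"] assms[of "axis 3 1"] assms[of "axis 4 1"]
  by (simp add: symp_form_def axis_def vec4_eq_iff)

lemma symp_exists_nonzero:
  assumes "v \<noteq> 0"
  obtains e where "symp_form v e \<noteq> 0"
  using symp_nondegenerate[of v 0] assms by (metis symp_scale_left vec.scale_zero_left mult_zero_left)

lemma subspace_perp: "vec.subspace (perp v)"
  by (rule vec.subspaceI) (auto simp: perp_def symp_add symp_scale, simp add: symp_form_def)

text \<open>Linear functionals with nested kernels are proportional: the factor is their ratio at
  one vector \<open>e\<close> off the smaller kernel, since every \<open>y\<close> can be moved into
  that kernel by a multiple of \<open>e\<close>.\<close>

lemma perp_subset_imp:
  assumes "v \<noteq> 0" and "perp v \<subseteq> perp w"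
  obtains c where "w = c *s v"
proof -
  obtain e where e: "symp_form v e \<noteq> 0"
    using assms(1) by (rule symp_exists_nonzero)
  have "symp_form w y = symp_form ((symp_form w e / symp_form v e) *s v) y" for y
  proof -
    have "symp_form v e *s y - symp_form v y *s e \<in> perp v"
      by (simp add: perp_def symp_diff symp_scale mult.commute)
    then have "symp_form v e *s y - symp_form v y *s e \<in> perp w"
      using assms(2) by blast
    then show ?thesis
      using e by (simp add: perp_def symp_diff symp_scale symp_scale_left field_simps)
  qed
  then show ?thesis
    using symp_nondegenerate that by blast
qed

lemma perp_scale: "c \<noteq> 0 \<Longrightarrow> perp (c *s v) = perp v"
  by (simp add: perp_def symp_scale_left)

lemma perp_eq_iff:
  assumes "v \<noteq> 0" and "w \<noteq> 0"
  shows "perp v = perp w \<longleftrightarrow> (\<exists>c. c \<noteq> 0 \<and> w = c *s v)"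
  using perp_subset_imp[of v w] assms perp_scale by (metis order_refl vec.scale_eq_0_iff)

text \<open>A single vector off the kernel of a nonzero functional completes the kernel to the whole
  space.\<close>

lemma dim_perp:
  assumes "v \<noteq> 0"
  shows "vec.dim (perp v) = 3"
proof -
  obtain e where e: "symp_form v e \<noteq> 0"
    using assms by (rule symp_exists_nonzero)
  have span: "vec.span (perp v) = perp v"
    using subspace_perp vec.span_eq_iff by blast
  have "x \<in> vec.span (insert e (perp v))" for x
  proof -
    have "x - (symp_form v x / symp_form v e) *s e \<in> perp v"
      using e by (simp add: perp_def symp_diff symp_scale)
    then show ?thesis
      unfolding vec.span_insert using span by blast
  qed
  then have "vec.span (insert e (perp v)) = UNIV"
    by auto
  then have "vec.dim (insert e (perp v)) = 4"
    using vec.dim_span[of "insert e (perp v)"] by (simp add: vec_dim_card del: vec.dim_UNIV)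
  moreover have "e \<notin> vec.span (perp v)"
    unfolding span using e by (simp add: perp_def)
  ultimately show ?thesis
    by (simp add: vec.dim_insert)
qed

lemma perp_in_planes: "v \<noteq> 0 \<Longrightarrow> perp v \<in> pg_planes"
  by (simp add: pg_planes_def subspace_perp dim_perp)

text \<open>Three linear conditions on four coordinates leave a nonzero vector orthogonal to a basis
  of the plane; equal dimensions then turn inclusion into equality.\<close>

lemma plane_obtain:
  assumes "S \<in> (pg_planes :: ('a::{field,finite} ^ 4) set set)"
  obtains v where "v \<noteq> 0" and "S = perp v"
proof -
  have S: "vec.subspace S" "vec.dim S = 3"
    using assms by (auto simp: pg_planes_def)
  obtain B where B: "B \<subseteq> S" "vec.independent B" "S \<subseteq> vec.span B" "card B = 3"
    using vec.basis_exists[of S] S by metis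
  then obtain x y z where xyz: "B = {x, y, z}"
    using card_3_iff[of B] by blast
  \<comment> \<open>The fourth entry 0 makes \<open>f\<close> an endomorphism that misses
    \<open>axis 4 1\<close>, so it cannot be injective either.\<close>
  define f where "f = (\<lambda>u::'a^4. vector [symp_form u x, symp_form u y, symp_form u z, 0] :: 'a ^ 4)"
  have "Vector_Spaces.linear (*s) (*s) f"
    by unfold_locales
      (auto simp: f_def vec4_eq_iff vector_4_nth symp_form_def algebra_simps)
  moreover have "\<not> surj f"
  proof
    assume "surj f"
    then obtain u where "f u = axis 4 1"
      by (metis surjD)
    then show False
      by (simp add: f_def vec4_eq_iff vector_4_nth axis_def)
  qed
  ultimately have "\<not> inj f"
    using vec.linear_inj_imp_surj by blast
  then obtain v w where vw: "v \<noteq> w" "f v = f w"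
    by (auto simp: inj_def)
  have diff: "symp_form (v - w) t = symp_form v t - symp_form w t" for t
    by (simp add: symp_form_def algebra_simps)
  have "B \<subseteq> perp (v - w)"
    using vw(2) unfolding xyz by (auto simp: f_def vec4_eq_iff vector_4_nth perp_def diff)
  then have "S \<subseteq> perp (v - w)"
    using B(3) vec.span_minimal[OF _ subspace_perp] by blast
  moreover have "vec.dim (perp (v - w)) \<le> vec.dim S"
    using dim_perp[of "v - w"] vw(1) S(2) by simp
  ultimately have "S = perp (v - w)"
    using vec.subspace_dim_equal S(1) subspace_perp by blast
  then show ?thesis
    using that[of "v - w"] vw(1) by simp
qed

lemma pt_subset_perp: "pt x \<subseteq> perp v \<longleftrightarrow> symp_form v x = 0"
proof
  assume "pt x \<subseteq> perp v"
  then show "symp_form v x = 0"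
    by (auto simp: pt_def perp_def intro: vec.span_base)
next
  assume "symp_form v x = 0"
  then show "pt x \<subseteq> perp v"
    by (auto simp: pt_def perp_def vec.span_singleton symp_scale)
qed

lemma pt_eq_iff_perp:
  assumes "v \<noteq> 0" and "w \<noteq> 0"
  shows "pt v = pt w \<longleftrightarrow> perp v = perp w"
proof
  assume "perp v = perp w"
  then obtain c where "c \<noteq> 0" "w = c *s v"
    using perp_eq_iff assms by blast
  then show "pt v = pt w"
    by (simp add: pt_def vec.span_image_scale[of "{v}" "\<lambda>_. c", simplified])
qed (metis polar_pt_perp)

lemma points_eq: "pg_points = pt ` {v. v \<noteq> 0}"
proof (intro equalityI subsetI)
  fix P :: "('a ^ 4) set"
  assume "P \<in> pg_points"
  then have P: "vec.subspace P" "vec.dim P = 1"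
    by (auto simp: pg_points_def)
  obtain B where B: "B \<subseteq> P" "vec.independent B" "P \<subseteq> vec.span B" "card B = 1"
    using vec.basis_exists[of P] P by metis
  then obtain v where v: "B = {v}"
    using card_1_singletonE by blast
  then have "P = pt v"
    using B P(1) vec.span_minimal[of B P] by (simp add: pt_def)
  moreover have "v \<noteq> 0"
    using B(2) v vec.dependent_zero by blast
  ultimately show "P \<in> pt ` {v. v \<noteq> 0}"
    by blast
next
  fix P :: "('a ^ 4) set"
  assume "P \<in> pt ` {v. v \<noteq> 0}"
  then obtain v where v: "v \<noteq> 0" "P = pt v"
    by blast
  have "vec.dim {v} = 1"
    using v(1) by (simp add: vec.dim_eq_card_independent)
  then show "P \<in> pg_points"
    by (simp add: v(2) pg_points_def pt_def)
qed

section \<open>The stabiliser of the arc\<close>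

lemma mat_image_arc_pts_on:
  assumes "inj ((*v) M)" and "mat_image M ` arc h = arc h"
  shows "arc_pts_on h (mat_image M \<pi>) = mat_image M ` arc_pts_on h \<pi>"
proof -
  have sub: "mat_image M P \<subseteq> mat_image M \<pi> \<longleftrightarrow> P \<subseteq> \<pi>" for P
    unfolding mat_image_def using assms(1) by (rule inj_image_subset_iff)
  have "arc_pts_on h (mat_image M \<pi>) = {P \<in> mat_image M ` arc h. P \<subseteq> mat_image M \<pi>}"
    by (simp add: arc_pts_on_def assms(2))
  also have "\<dots> = mat_image M ` {P \<in> arc h. mat_image M P \<subseteq> mat_image M \<pi>}"
    by blast
  also have "\<dots> = mat_image M ` arc_pts_on h \<pi>"
    by (simp add: arc_pts_on_def sub)
  finally show ?thesis .
qed

lemma inj_mat_image: "inj ((*v) M) \<Longrightarrow> inj (mat_image M)"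
  unfolding mat_image_def by (rule injI) (simp add: inj_image_eq_iff)

definition arc_stab :: "nat \<Rightarrow> ('a::{field,finite} ^ 4 ^ 4) set" where
  "arc_stab h = {M. invertible M \<and> mat_image M ` arc h = arc h}"

lemma inj_invertible: "invertible (M :: 'a::field ^ 'n ^ 'n) \<Longrightarrow> inj ((*v) M)"
  by (metis inj_matrix_vector_mult)

lemma mat_image_mult: "mat_image (M ** N) S = mat_image M (mat_image N S)"
  by (auto simp: mat_image_def image_image matrix_vector_mul_assoc)

lemma mat_image_one [simp]: "mat_image (mat 1) S = S"
  by (simp add: mat_image_def)

lemma arc_stab_mult: "M \<in> arc_stab h \<Longrightarrow> N \<in> arc_stab h \<Longrightarrow> M ** N \<in> arc_stab h"
  by (simp add: arc_stab_def mat_image_mult invertible_mult flip: image_image)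

lemma arc_stab_one: "mat 1 \<in> arc_stab h"
  by (auto simp: arc_stab_def invertible_def intro: exI[of _ "mat 1"])

lemma arc_stab_inverse:
  assumes "M \<in> arc_stab h"
  obtains N where "N \<in> arc_stab h" and "N ** M = mat 1" and "M ** N = mat 1"
proof -
  obtain N where N: "M ** N = mat 1" "N ** M = mat 1"
    using assms by (auto simp: arc_stab_def invertible_def)
  have "mat_image N ` arc h = mat_image N ` mat_image M ` arc h"
    using assms by (simp add: arc_stab_def)
  also have "\<dots> = arc h"
    by (simp add: image_image N flip: mat_image_mult)
  finally show ?thesis
    using that N by (auto simp: arc_stab_def invertible_def)
qed

definition arc_equiv :: "nat \<Rightarrow> ('a::{field,finite} ^ 4) set \<Rightarrow> ('a ^ 4) set \<Rightarrow> bool" where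
  "arc_equiv h \<pi> \<rho> \<longleftrightarrow> (\<exists>M\<in>arc_stab h. \<rho> = mat_image M \<pi>)"

lemma arc_equiv_refl: "arc_equiv h \<pi> \<pi>"
  unfolding arc_equiv_def using arc_stab_one by (metis mat_image_one)

lemma arc_equiv_sym: "arc_equiv h \<pi> \<rho> \<Longrightarrow> arc_equiv h \<rho> \<pi>"
  unfolding arc_equiv_def by (metis arc_stab_inverse mat_image_mult mat_image_one)

lemma arc_equiv_trans: "arc_equiv h \<pi> \<rho> \<Longrightarrow> arc_equiv h \<rho> \<tau> \<Longrightarrow> arc_equiv h \<pi> \<tau>"
  unfolding arc_equiv_def by (metis arc_stab_mult mat_image_mult)

lemma mat_image_plane:
  assumes "invertible M" and "\<pi> \<in> pg_planes"
  shows "mat_image M \<pi> \<in> pg_planes"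
proof -
  have \<pi>: "vec.subspace \<pi>" "vec.dim \<pi> = 3"
    using assms(2) by (auto simp: pg_planes_def)
  have lin: "Vector_Spaces.linear (*s) (*s) ((*v) M)"
    by (rule matrix_vector_mul_linear_gen)
  have "vec.subspace (mat_image M \<pi>)"
    unfolding mat_image_def using lin \<pi>(1) by (rule vec.linear_subspace_image)
  moreover have "vec.dim (mat_image M \<pi>) = 3"
    unfolding mat_image_def using vec.dim_image_eq[OF lin inj_on_subset[OF inj_invertible[OF assms(1)] subset_UNIV]] \<pi>(2)
    by simp
  ultimately show ?thesis
    by (simp add: pg_planes_def)
qed

lemma arc_equiv_card: "arc_equiv h \<pi> \<rho> \<Longrightarrow> card (arc_pts_on h \<rho>) = card (arc_pts_on h \<pi>)"
  by (auto simp: arc_equiv_def arc_stab_def mat_image_arc_pts_on[OF inj_invertible]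
      card_image inj_on_subset[OF inj_mat_image[OF inj_invertible]])

lemma arc_subset_subspaces: "arc h \<subseteq> pg_subspaces"
  by (auto simp: arc_def arc_pt_def pt_def pg_subspaces_def vec.subspace_span)

text \<open>Replaces the group of restricted functions by matrices: planes and arc points are
  subspaces, where the restriction has no effect.\<close>

lemma orbit_arc_group:
  fixes \<pi> :: "('a::{field,finite} ^ 4) set"
  assumes "\<pi> \<in> pg_planes"
  shows "orbit (arc_group h) (\<lambda>g. g) \<pi> = {\<rho>. arc_equiv h \<pi> \<rho>}"
proof -
  have sub: "projectivity M ` arc h = mat_image M ` arc h" for M :: "'a ^ 4 ^ 4"
    using arc_subset_subspaces by (intro image_cong) (auto simp: projectivity_def mat_image_def)
  have "carrier (arc_group h) = projectivity ` (arc_stab h :: ('a ^ 4 ^ 4) set)"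
    unfolding arc_group_def stabilizer_def PGL4_def arc_stab_def by (simp flip: sub) blast
  moreover have "projectivity M \<pi> = mat_image M \<pi>" for M
    using assms by (simp add: projectivity_def mat_image_def pg_planes_def pg_subspaces_def)
  ultimately show ?thesis
    by (auto simp: orbit_def arc_equiv_def)
qed

text \<open>This property of a plane is invariant under all projectivities that preserve the arc, and
  it turns out to characterise the osculating planes; hence these are permuted by the full
  stabiliser of the arc, not just by the matrices \<open>gmat\<close>.\<close>

definition tangential :: "nat \<Rightarrow> ('a::{field,finite} ^ 4) set \<Rightarrow> bool" where
  "tangential h \<pi> \<longleftrightarrow> card (arc_pts_on h \<pi>) = 1 \<and>
     (\<forall>\<rho>\<in>pg_planes. \<forall>\<tau>\<in>pg_planes. card (arc_pts_on h \<rho>) = 2 \<longrightarrow>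
        arc_pts_on h \<pi> \<subseteq> arc_pts_on h \<rho> \<longrightarrow> \<pi> \<inter> \<rho> \<subseteq> \<tau> \<longrightarrow> \<tau> \<noteq> \<pi> \<longrightarrow> card (arc_pts_on h \<tau>) = 2)"

text \<open>Test planes for the image are pulled back to test planes for \<open>\<pi>\<close> by the
  inverse matrix, which stabilises the arc as well.\<close>

lemma tangential_mat_image:
  assumes M: "M \<in> arc_stab h" and tan: "tangential h \<pi>"
  shows "tangential h (mat_image M \<pi>)"
proof -
  obtain N where N: "N \<in> arc_stab h" and NM: "N ** M = mat 1" and MN: "M ** N = mat 1"
    using M by (rule arc_stab_inverse)
  have inj: "inj ((*v) N)" and inv: "invertible N" and arc: "mat_image N ` arc h = arc h"
    using N inj_invertible by (auto simp: arc_stab_def)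
  have undo: "mat_image N (mat_image M S) = S" "mat_image M (mat_image N S) = S" for S
    by (simp_all add: NM MN flip: mat_image_mult)
  have card_N: "card (arc_pts_on h (mat_image N S)) = card (arc_pts_on h S)" for S
    using N arc_equiv_card unfolding arc_equiv_def by blast
  have step: "card (arc_pts_on h \<tau>) = 2"
    if "\<rho> \<in> pg_planes" "\<tau> \<in> pg_planes" "card (arc_pts_on h \<rho>) = 2"
      "arc_pts_on h \<pi> \<subseteq> arc_pts_on h \<rho>" "\<pi> \<inter> \<rho> \<subseteq> \<tau>" "\<tau> \<noteq> \<pi>"
    for \<rho> \<tau>
    using tan that unfolding tangential_def by blast
  have "card (arc_pts_on h (mat_image M \<pi>)) = 1"
    using tan card_N[of "mat_image M \<pi>"] by (simp add: undo tangential_def)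
  moreover have "card (arc_pts_on h \<tau>) = 2"
    if \<rho>: "\<rho> \<in> pg_planes" "card (arc_pts_on h \<rho>) = 2" and \<tau>: "\<tau> \<in> pg_planes"
      and sub: "arc_pts_on h (mat_image M \<pi>) \<subseteq> arc_pts_on h \<rho>" "mat_image M \<pi> \<inter> \<rho> \<subseteq> \<tau>"
      and neq: "\<tau> \<noteq> mat_image M \<pi>"
    for \<rho> \<tau>
  proof -
    have "arc_pts_on h (mat_image N (mat_image M \<pi>)) \<subseteq> arc_pts_on h (mat_image N \<rho>)"
      unfolding mat_image_arc_pts_on[OF inj arc] using sub(1) by (rule image_mono)
    then have "arc_pts_on h \<pi> \<subseteq> arc_pts_on h (mat_image N \<rho>)"
      by (simp only: undo)
    moreover have "mat_image N (mat_image M \<pi>) \<inter> mat_image N \<rho> \<subseteq> mat_image N \<tau>"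
      using sub(2) unfolding mat_image_def image_Int[OF inj, symmetric] by (rule image_mono)
    then have "\<pi> \<inter> mat_image N \<rho> \<subseteq> mat_image N \<tau>"
      by (simp only: undo)
    moreover have "mat_image N \<tau> \<noteq> \<pi>"
      using neq undo by metis
    moreover have "card (arc_pts_on h (mat_image N \<rho>)) = 2"
      by (simp only: card_N \<rho>(2))
    ultimately have "card (arc_pts_on h (mat_image N \<tau>)) = 2"
      using step mat_image_plane[OF inv \<rho>(1)] mat_image_plane[OF inv \<tau>] by blast
    then show ?thesis
      by (simp add: card_N)
  qed
  ultimately show ?thesis
    unfolding tangential_def by blast
qed

lemma tangential_equiv: "arc_equiv h \<pi> \<rho> \<Longrightarrow> tangential h \<rho> \<longleftrightarrow> tangential h \<pi>"
  using arc_equiv_sym tangential_mat_image unfolding arc_equiv_def by metis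

section \<open>Counting by fibres\<close>

text \<open>Later plays the part of the orbit-stabiliser theorem, as an inequality with
  \<open>k\<close> bounding the stabiliser.\<close>

lemma card_le_fibres:
  assumes "finite A" and "\<And>y. y \<in> f ` A \<Longrightarrow> card {x \<in> A. f x = y} \<le> k"
  shows "card A \<le> k * card (f ` A)"
proof -
  have "A = (\<Union>y\<in>f ` A. {x \<in> A. f x = y})"
    by blast
  then have "card A \<le> (\<Sum>y\<in>f ` A. card {x \<in> A. f x = y})"
    using card_UN_le[of "f ` A" "\<lambda>y. {x \<in> A. f x = y}"] assms(1) by simp
  also have "\<dots> \<le> k * card (f ` A)"
    using sum_bounded_above[of "f ` A" "\<lambda>y. card {x \<in> A. f x = y}" k] assms(2)
    by (simp add: mult.commute)
  finally show ?thesis .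
qed

text \<open>Lets planes be counted by coordinate vectors: each plane is the polar of one vector up
  to its q - 1 nonzero multiples.\<close>

lemma card_vectors_of_planes:
  assumes "C \<subseteq> (pg_planes :: ('a::{field,finite} ^ 4) set set)"
  shows "card {v. v \<noteq> 0 \<and> perp v \<in> C} = (CARD('a) - 1) * card C"
proof -
  let ?V = "\<lambda>\<pi>. {v::'a ^ 4. v \<noteq> 0 \<and> perp v = \<pi>}"
  have card_V: "card (?V \<pi>) = CARD('a) - 1" and ne_V: "?V \<pi> \<noteq> {}" if \<pi>: "\<pi> \<in> C" for \<pi>
  proof -
    obtain v where v: "v \<noteq> 0" "\<pi> = perp v"
      using \<pi> assms plane_obtain by (metis subsetD)
    have "x \<noteq> 0 \<and> perp x = \<pi> \<longleftrightarrow> (\<exists>c. c \<noteq> 0 \<and> x = c *s v)" for x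
      using perp_eq_iff[OF v(1), of x] perp_scale[of _ v] v by (metis vec.scale_eq_0_iff)
    then have V: "?V \<pi> = (\<lambda>c. c *s v) ` (UNIV - {0})"
      by blast
    moreover have "inj_on (\<lambda>c. c *s v) (UNIV - {0})"
      using v(1) by (auto intro!: inj_onI)
    ultimately show "card (?V \<pi>) = CARD('a) - 1"
      by (simp add: card_image card_Diff_subset)
    show "?V \<pi> \<noteq> {}"
      using v by blast
  qed
  have "(CARD('a) - 1) * card (?V ` C) = card (\<Union> (?V ` C))"
    by (rule card_partition) (auto simp: card_V)
  moreover have "inj_on ?V C"
    by (rule inj_onI) (use ne_V in blast)
  moreover have "\<Union> (?V ` C) = {v. v \<noteq> 0 \<and> perp v \<in> C}"
    by blast
  ultimately show ?thesis
    by (simp add: card_image)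
qed

section \<open>The twisted action of \<open>SL(2,q)\<close>\<close>

text \<open>The coprimality of \<open>n\<close> and \<open>h\<close> enters as
  \<open>s_fixed\<close>. The bound \<open>card_gt_2\<close> yields a scalar other than 0 and 1 and
  makes the classes of planes nonempty.\<close>

locale twisted_arc =
  fixes h :: nat and s :: "'a::{field,finite} \<Rightarrow> 'a"
  assumes s_eq: "s x = x ^ (2 ^ h)"
    and char_2: "CHAR('a) = 2"
    and s_fixed: "s x = x \<Longrightarrow> x = 0 \<or> x = 1"
    and card_gt_2: "CARD('a) > 2"
begin

lemma two_eq_0 [simp]: "(2::'a) = 0"
  using of_nat_CHAR[where ?'a = 'a] char_2 by simp

lemma double [simp]: "(x::'a) + x = 0"
  by (simp flip: mult_2)

lemma double_left [simp]: "(x::'a) + (x + y) = y"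
  by (simp flip: add.assoc)

lemma uminus_eq [simp]: "- (x::'a) = x"
  by (rule minus_unique) simp

lemma minus_eq [simp]: "(x::'a) - y = x + y"
  by (simp add: diff_conv_add_uminus del: add_uminus_conv_diff)

lemma add_eq_0_iff_eq: "(x::'a) + y = 0 \<longleftrightarrow> x = y"
  by (metis double double_left add_0_right)

lemma s_0 [simp]: "s 0 = 0" and s_1 [simp]: "s 1 = 1"
  and s_mult: "s (x * y) = s x * s y"
  and s_divide: "s (x / y) = s x / s y"
  and s_eq_0_iff [simp]: "s x = 0 \<longleftrightarrow> x = 0"
  by (simp_all add: s_eq power_mult_distrib power_divide)

lemma s_add: "s (x + y) = s x + s y"
  by (simp add: s_eq freshmans_dream' char_2)

lemma inj_s: "inj s"
proof (rule injI)
  fix x y assume "s x = s y"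
  then have "s (x + y) = 0"
    by (simp add: s_add)
  then show "x = y"
    by (simp add: add_eq_0_iff_eq)
qed

text \<open>A vector \<open>x\<close> is read as the \<open>2 \<times> 2\<close> matrix \<open>X\<close> with rows
  \<open>(x\<^sub>1, x\<^sub>2)\<close> and \<open>(x\<^sub>3, x\<^sub>4)\<close>; for \<open>g\<close> with rows \<open>(a, b)\<close> and \<open>(c, d)\<close>, the matrix
  \<open>gmat a b c d\<close> acts by \<open>X \<mapsto> s(g) X g\<^sup>T\<close>, and \<open>arcv u w\<close> is \<open>s(z) z\<^sup>T\<close> for the column
  \<open>z = (u, w)\<^sup>T\<close>. The form \<open>qform\<close> is the determinant of \<open>X\<close>, up to a sign that does not
  matter in characteristic 2.\<close>

definition gmat :: "'a \<Rightarrow> 'a \<Rightarrow> 'a \<Rightarrow> 'a \<Rightarrow> 'a ^ 4 ^ 4" where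
  "gmat a b c d = vector
     [vector [s a * a, s a * b, s b * a, s b * b],
      vector [s a * c, s a * d, s b * c, s b * d],
      vector [s c * a, s c * b, s d * a, s d * b],
      vector [s c * c, s c * d, s d * c, s d * d]]"

definition arcv :: "'a \<Rightarrow> 'a \<Rightarrow> 'a ^ 4" where
  "arcv u w = vector [s u * u, s u * w, s w * u, s w * w]"

definition qform :: "'a ^ 4 \<Rightarrow> 'a" where
  "qform v = v $ 1 * v $ 4 + v $ 2 * v $ 3"

lemma gmat_nth:
  "(gmat a b c d *v x) $ 1 = s a * a * x $ 1 + s a * b * x $ 2 + s b * a * x $ 3 + s b * b * x $ 4"
  "(gmat a b c d *v x) $ 2 = s a * c * x $ 1 + s a * d * x $ 2 + s b * c * x $ 3 + s b * d * x $ 4"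
  "(gmat a b c d *v x) $ 3 = s c * a * x $ 1 + s c * b * x $ 2 + s d * a * x $ 3 + s d * b * x $ 4"
  "(gmat a b c d *v x) $ 4 = s c * c * x $ 1 + s c * d * x $ 2 + s d * c * x $ 3 + s d * d * x $ 4"
  by (simp_all add: gmat_def matrix_vector_mult_def sum_4 vector_4_nth)

lemma arcv_nth:
  "arcv u w $ 1 = s u * u" "arcv u w $ 2 = s u * w" "arcv u w $ 3 = s w * u" "arcv u w $ 4 = s w * w"
  by (simp_all add: arcv_def vector_4_nth)

lemma gmat_arcv: "gmat a b c d *v arcv u w = arcv (a * u + b * w) (c * u + d * w)"
  by (simp add: vec4_eq_iff gmat_nth arcv_nth s_add s_mult algebra_simps)

lemma gmat_mult:
  "gmat a b c d *v (gmat a' b' c' d' *v x) =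
     gmat (a * a' + b * c') (a * b' + b * d') (c * a' + d * c') (c * b' + d * d') *v x"
  by (simp add: vec4_eq_iff gmat_nth s_add s_mult algebra_simps)

lemma gmat_one: "gmat 1 0 0 1 *v x = x"
  by (simp add: vec4_eq_iff gmat_nth)

text \<open>In characteristic 2 the adjugate only exchanges the diagonal entries, and for
  determinant 1 it is the inverse.\<close>

lemma gmat_inverse:
  assumes "a * d + b * c = 1"
  shows "gmat d b c a *v (gmat a b c d *v x) = x"
    and "gmat a b c d *v (gmat d b c a *v x) = x"
  using assms by (simp_all add: gmat_mult gmat_one mult.commute add.commute)

lemma inj_gmat: "a * d + b * c = 1 \<Longrightarrow> inj ((*v) (gmat a b c d))"
  by (metis gmat_inverse(1) injI)

lemma invertible_gmat:
  assumes "a * d + b * c = 1"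
  shows "invertible (gmat a b c d)"
  unfolding invertible_def
  by (rule exI[of _ "gmat d b c a"])
    (simp add: matrix_eq gmat_inverse[OF assms] flip: matrix_vector_mul_assoc)

lemma qform_gmat:
  assumes "a * d + b * c = 1"
  shows "qform (gmat a b c d *v x) = qform x"
proof -
  have "qform (gmat a b c d *v x) = s (a * d + b * c) * (a * d + b * c) * qform x"
    by (simp add: qform_def gmat_nth s_add s_mult algebra_simps)
  then show ?thesis
    by (simp add: assms)
qed

lemma symp_qform: "symp_form x y = qform (x + y) + qform x + qform y"
  by (simp add: symp_form_def qform_def algebra_simps)

lemma symp_gmat:
  assumes "a * d + b * c = 1"
  shows "symp_form (gmat a b c d *v x) (gmat a b c d *v y) = symp_form x y"
  by (simp add: symp_qform qform_gmat[OF assms] flip: matrix_vector_right_distrib)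

lemma perp_gmat:
  assumes "a * d + b * c = 1"
  shows "perp (gmat a b c d *v v) = mat_image (gmat a b c d) (perp v)"
proof (intro equalityI subsetI)
  fix y assume "y \<in> perp (gmat a b c d *v v)"
  then have "gmat d b c a *v y \<in> perp v"
    using symp_gmat[OF assms, of v "gmat d b c a *v y"] by (simp add: perp_def gmat_inverse[OF assms])
  then show "y \<in> mat_image (gmat a b c d) (perp v)"
    unfolding mat_image_def using gmat_inverse(2)[OF assms] by (metis imageI)
qed (auto simp: mat_image_def perp_def symp_gmat[OF assms])

lemma arcv_eq_0_iff [simp]: "arcv u w = 0 \<longleftrightarrow> u = 0 \<and> w = 0"
  by (auto simp: vec4_eq_iff arcv_nth)

lemma arcv_scale: "arcv (k * u) (k * w) = (s k * k) *s arcv u w"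
  by (simp add: vec4_eq_iff arcv_nth s_mult)

lemma pt_scale: "c \<noteq> 0 \<Longrightarrow> pt (c *s v) = pt v"
  for c :: 'a and v :: "'a ^ 4"
  by (simp add: pt_def vec.span_image_scale[of "{v}" "\<lambda>_. c", simplified])

lemma arc_pt_arcv: "arc_pt h t = pt (arcv 1 t)"
  by (simp add: arc_pt_def arcv_def s_eq mult.commute)

lemma axis_4_arcv: "axis 4 1 = arcv 0 1"
  by (simp add: vec4_eq_iff arcv_nth axis_def)

lemma arc_eq: "arc h = {pt (arcv u w) | u w. u \<noteq> 0 \<or> w \<noteq> 0}"
proof (intro equalityI subsetI)
  fix P assume "P \<in> {pt (arcv u w) | u w. u \<noteq> 0 \<or> w \<noteq> 0}"
  then obtain u w where P: "P = pt (arcv u w)" and uw: "u \<noteq> 0 \<or> w \<noteq> 0"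
    by blast
  show "P \<in> arc h"
  proof (cases "u = 0")
    case True
    then have "P = pt (arcv 0 1)"
      using pt_scale[of "s w * w" "arcv 0 1"] arcv_scale[of w 0 1] uw P by simp
    then show ?thesis
      by (simp add: arc_def axis_4_arcv)
  next
    case False
    then have "P = arc_pt h (w / u)"
      using pt_scale[of "s u * u" "arcv 1 (w / u)"] arcv_scale[of u 1 "w / u"] P
      by (simp add: arc_pt_arcv)
    then show ?thesis
      by (simp add: arc_def)
  qed
next
  fix P assume "P \<in> (arc h :: ('a ^ 4) set set)"
  then show "P \<in> {pt (arcv u w) | u w. u \<noteq> 0 \<or> w \<noteq> 0}"
    unfolding arc_def axis_4_arcv arc_pt_arcv by fastforce
qed

lemma mat_image_pt: "mat_image M (pt v) = pt (M *v v)"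
  unfolding mat_image_def pt_def
  using vec.linear_span_image[OF matrix_vector_mul_linear_gen, of M "{v}"] by simp

lemma gmat_arc_stab:
  assumes "a * d + b * c = 1"
  shows "gmat a b c d \<in> arc_stab h"
proof -
  have "mat_image (gmat a b c d) ` arc h \<subseteq> arc h"
  proof
    fix P assume "P \<in> mat_image (gmat a b c d) ` arc h"
    then obtain u w where uw: "u \<noteq> 0 \<or> w \<noteq> 0" and P: "P = mat_image (gmat a b c d) (pt (arcv u w))"
      unfolding arc_eq by blast
    have "gmat a b c d *v arcv u w \<noteq> 0"
      using uw gmat_inverse(1)[OF assms, of "arcv u w"] by auto
    then show "P \<in> arc h"
      unfolding P mat_image_pt arc_eq gmat_arcv by auto
  qed
  \<comment> \<open>An injective map of the finite arc into itself is onto.\<close>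
  moreover have "inj_on (mat_image (gmat a b c d)) (arc h)"
    using inj_mat_image[OF inj_gmat[OF assms]] by (rule inj_on_subset) simp
  ultimately have "mat_image (gmat a b c d) ` arc h = arc h"
    by (simp add: card_image card_subset_eq)
  then show ?thesis
    by (simp add: arc_stab_def invertible_gmat[OF assms])
qed

lemma equiv_gmat: "a * d + b * c = 1 \<Longrightarrow> arc_equiv h (perp v) (perp (gmat a b c d *v v))"
  unfolding arc_equiv_def using gmat_arc_stab perp_gmat by blast

lemma arcv_1_inj: "inj (\<lambda>t. pt (arcv 1 t))"
proof (rule injI)
  fix t t' assume "pt (arcv 1 t) = pt (arcv 1 t')"
  then obtain c where "arcv 1 t' = c *s arcv 1 t"
    using pt_eq_iff_perp[of "arcv 1 t" "arcv 1 t'"] perp_eq_iff[of "arcv 1 t" "arcv 1 t'"] by auto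
  then show "t = t'"
    by (auto simp: vec4_eq_iff arcv_nth)
qed

lemma arcv_0_neq: "pt (arcv 0 1) \<noteq> pt (arcv 1 t)"
proof
  assume "pt (arcv 0 1) = pt (arcv 1 t)"
  then obtain c where "arcv 1 t = c *s arcv 0 1"
    using pt_eq_iff_perp[of "arcv 0 1" "arcv 1 t"] perp_eq_iff[of "arcv 0 1" "arcv 1 t"] by auto
  then show False
    by (auto simp: vec4_eq_iff arcv_nth)
qed

lemma arc_eq_insert: "arc h = insert (pt (arcv 0 1)) (range (\<lambda>t. pt (arcv 1 t)))"
  by (auto simp: arc_def axis_4_arcv arc_pt_arcv)

lemma card_arc: "card (arc h :: ('a ^ 4) set set) = CARD('a) + 1"
  unfolding arc_eq_insert using arcv_0_neq
  by (subst card_insert_disjoint) (auto simp: card_image[OF arcv_1_inj])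

text \<open>The condition \<open>v $ 1 = 0\<close> puts \<open>U4\<close> on the plane, which gives
  the summand 1; the equation is the form evaluated at \<open>arcv 1 t\<close>.\<close>

lemma card_arc_pts_on_perp:
  assumes "v $ 1 = 0"
  shows "card (arc_pts_on h (perp v)) = 1 + card {t. v $ 2 * s t + v $ 3 * t + v $ 4 = 0}"
proof -
  let ?T = "{t. v $ 2 * s t + v $ 3 * t + v $ 4 = 0}"
  have filter: "{P \<in> insert x (range f). Q P} = insert x (f ` {t. Q (f t)})" if "Q x"
    for Q :: "('a ^ 4) set \<Rightarrow> bool" and x and f :: "'a \<Rightarrow> ('a ^ 4) set"
    using that by auto
  have "arc_pts_on h (perp v) = insert (pt (arcv 0 1)) ((\<lambda>t. pt (arcv 1 t)) ` ?T)"
    using filter[of "\<lambda>P. P \<subseteq> perp v"] assms unfolding arc_pts_on_def arc_eq_insert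
    by (simp add: pt_subset_perp symp_form_def arcv_nth)
  moreover have "card ((\<lambda>t. pt (arcv 1 t)) ` ?T) = card ?T"
    by (rule card_image[OF inj_on_subset[OF arcv_1_inj subset_UNIV]])
  moreover have "pt (arcv 0 1) \<notin> (\<lambda>t. pt (arcv 1 t)) ` ?T"
    using arcv_0_neq by blast
  ultimately show ?thesis
    by simp
qed


section \<open>Planes through a point of the arc\<close>

text \<open>The diagonal matrix \<open>gmat x 0 0 (1 / x)\<close> changes the ratio of the second to
  the third coordinate by the factor \<open>(s x / x)\<^sup>2\<close>. Squaring is injective in
  characteristic 2, and equal values of \<open>s x / x\<close> and \<open>s y / y\<close> make
  \<open>x / y\<close> a fixed point of \<open>s\<close>.\<close>

lemma inj_on_s_ratio: "inj_on (\<lambda>x. (s x / x)\<^sup>2) (UNIV - {0})"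
proof (rule inj_onI)
  fix x y assume x: "x \<in> UNIV - {0}" and y: "y \<in> UNIV - {0}" and eq: "(s x / x)\<^sup>2 = (s y / y)\<^sup>2"
  from eq have "(s x / x + s y / y)\<^sup>2 = 0"
    by (simp add: power2_eq_square algebra_simps)
  then have "s x / x = s y / y"
    by (simp add: add_eq_0_iff_eq)
  then have "s (x / y) = x / y"
    using x y by (simp add: s_divide field_simps)
  then show "x = y"
    using s_fixed[of "x / y"] x y by simp
qed

lemma s_ratio_obtain:
  assumes "k \<noteq> 0"
  obtains x where "x \<noteq> 0" and "(s x / x)\<^sup>2 = k"
proof -
  have "(\<lambda>x. (s x / x)\<^sup>2) ` (UNIV - {0}) = UNIV - {0}"
    by (rule endo_inj_surj[OF _ _ inj_on_s_ratio]) auto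
  then show ?thesis
    using assms that by (metis (no_types, lifting) DiffD2 DiffI UNIV_I image_iff singletonD singletonI)
qed

text \<open>A nonzero root \<open>r\<close> exists because every nonzero scalar has the form
  \<open>(s x / x)\<^sup>2\<close>, which is applied to the square of \<open>c / b\<close>. It is
  the only one, since for another root \<open>t\<close> the quotient \<open>t / r\<close> is fixed
  by \<open>s\<close>.\<close>

lemma affine_kernel:
  assumes "b \<noteq> 0" and "c \<noteq> 0"
  obtains k where "k \<noteq> 0" and "\<And>t. b * s t + c * t = 0 \<longleftrightarrow> t = 0 \<or> t = k"
proof -
  obtain r where r: "r \<noteq> 0" "(s r / r)\<^sup>2 = (c / b)\<^sup>2"
    using s_ratio_obtain[of "(c / b)\<^sup>2"] assms by auto
  have "(s r / r + c / b)\<^sup>2 = 0"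
    using r(2) by (simp add: power2_eq_square algebra_simps)
  then have "s r / r = c / b"
    by (simp add: add_eq_0_iff_eq)
  then have r': "b * s r = c * r"
    using r(1) assms(1) by (simp add: field_simps)
  have "b * s t + c * t = 0 \<longleftrightarrow> t = 0 \<or> t = r" for t
  proof
    assume "b * s t + c * t = 0"
    then have "b * s t = c * t"
      by (simp add: add_eq_0_iff_eq)
    then have "b * s t * (c * r) = c * t * (b * s r)"
      by (simp add: r')
    then have "s (t / r) = t / r"
      using assms r(1) by (simp add: s_divide field_simps)
    then show "t = 0 \<or> t = r"
      using s_fixed[of "t / r"] r(1) by auto
  qed (auto simp: r')
  then show ?thesis
    using that r(1) by blast
qed

lemma affine_roots_one:
  assumes "(b = 0) \<noteq> (c = 0)"
  shows "card {t. b * s t + c * t + a = 0} = 1"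
proof -
  let ?f = "\<lambda>t. b * s t + c * t"
  have inj: "inj ?f"
    using assms inj_s by (cases "b = 0") (auto simp: inj_def)
  then have "surj ?f"
    by (simp add: finite_UNIV_inj_surj)
  then obtain t where t: "?f t = a"
    using surjD[of ?f a] by force
  then have "?f x = a \<longleftrightarrow> x = t" for x
    using inj_eq[OF inj, of x t] by (simp only: t)
  then have "{t. b * s t + c * t + a = 0} = {t}"
    by (simp add: add_eq_0_iff_eq)
  then show ?thesis
    by simp
qed

text \<open>The roots form a coset of the two-element kernel of the additive part.\<close>

lemma affine_roots_two:
  assumes "b \<noteq> 0" and "c \<noteq> 0" and t0: "b * s t0 + c * t0 + a = 0"
  shows "card {t. b * s t + c * t + a = 0} = 2"
proof -
  obtain k where k: "k \<noteq> 0" "\<And>t. b * s t + c * t = 0 \<longleftrightarrow> t = 0 \<or> t = k"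
    using affine_kernel assms by metis
  have "b * s t + c * t + a = 0 \<longleftrightarrow> t = t0 \<or> t = t0 + k" for t
  proof -
    have "b * s t + c * t + a = b * s (t + t0) + c * (t + t0) + (b * s t0 + c * t0 + a)"
      by (simp add: s_add algebra_simps)
    then have "b * s t + c * t + a = 0 \<longleftrightarrow> t + t0 = 0 \<or> t + t0 = k"
      by (simp add: t0 k(2))
    then show ?thesis
      by (metis add.commute add_eq_0_iff_eq double_left)
  qed
  then have "{t. b * s t + c * t + a = 0} = {t0, t0 + k}"
    by auto
  then show ?thesis
    using k(1) by simp
qed

text \<open>The additive map is two-to-one, so its fibres cut the field into pairs and it takes
  exactly half of all values.\<close>

lemma card_affine_image:
  assumes "b \<noteq> 0" and "c \<noteq> 0"
  shows "2 * card {a. \<exists>t. b * s t + c * t + a = 0} = CARD('a)"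
    and "2 * card {a. \<nexists>t. b * s t + c * t + a = 0} = CARD('a)"
proof -
  let ?f = "\<lambda>a. {t. b * s t + c * t + a = 0}" and ?I = "{a. \<exists>t. b * s t + c * t + a = 0}"
  have uniq: "a = a'" if "t \<in> ?f a" "t \<in> ?f a'" for a a' t
    using that by (auto simp: add_eq_0_iff_eq)
  have "2 * card (?f ` ?I) = card (\<Union> (?f ` ?I))"
  proof (rule card_partition)
    show "card c = 2" if "c \<in> ?f ` ?I" for c
      using that affine_roots_two[OF assms] by blast
    show "c \<inter> c' = {}" if "c \<in> ?f ` ?I" "c' \<in> ?f ` ?I" "c \<noteq> c'" for c c'
      using that uniq by blast
  qed auto
  moreover have "\<Union> (?f ` ?I) = UNIV"
    by (auto simp: add_eq_0_iff_eq)
  moreover have "inj_on ?f ?I"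
    by (rule inj_onI) (use uniq in blast)
  ultimately show image: "2 * card ?I = CARD('a)"
    by (simp add: card_image)
  have "{a. \<nexists>t. b * s t + c * t + a = 0} = UNIV - ?I"
    by auto
  then have "card {a. \<nexists>t. b * s t + c * t + a = 0} = CARD('a) - card ?I"
    by (simp add: card_Diff_subset)
  then show "2 * card {a. \<nexists>t. b * s t + c * t + a = 0} = CARD('a)"
    using image by simp
qed

text \<open>One point for \<open>U4\<close> plus 0, 1 or 2 affine roots. The count 1 arises in two
  unrelated ways, the first being the osculating plane; counting arc points alone therefore does not
  separate the orbits.\<close>

lemma card_arc_pts_on_cases:
  fixes v :: "'a ^ 4"
  assumes "v $ 1 = 0" and "v \<noteq> 0"
  shows "v $ 2 = 0 \<Longrightarrow> v $ 3 = 0 \<Longrightarrow> card (arc_pts_on h (perp v)) = 1"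
    and "(v $ 2 = 0) \<noteq> (v $ 3 = 0) \<Longrightarrow> card (arc_pts_on h (perp v)) = 2"
    and "v $ 2 \<noteq> 0 \<Longrightarrow> v $ 3 \<noteq> 0 \<Longrightarrow> \<exists>t. v $ 2 * s t + v $ 3 * t + v $ 4 = 0 \<Longrightarrow>
      card (arc_pts_on h (perp v)) = 3"
    and "v $ 2 \<noteq> 0 \<Longrightarrow> v $ 3 \<noteq> 0 \<Longrightarrow> \<nexists>t. v $ 2 * s t + v $ 3 * t + v $ 4 = 0 \<Longrightarrow>
      card (arc_pts_on h (perp v)) = 1"
  using assms affine_roots_one[of "v $ 2" "v $ 3" "v $ 4"]
    affine_roots_two[of "v $ 2" "v $ 3" _ "v $ 4"]
  by (auto simp: card_arc_pts_on_perp vec4_eq_iff)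

lemma osculating_eq: "osculating_planes h = {perp (arcv u w) | u w. u \<noteq> 0 \<or> w \<noteq> 0}"
  unfolding osculating_planes_def arc_eq using polar_pt_perp by fastforce

text \<open>The only osculating plane through \<open>U4\<close> is its own: a vanishing first
  coordinate \<open>s u * u\<close> forces \<open>u = 0\<close>.\<close>

lemma osculating_iff:
  fixes v :: "'a ^ 4"
  assumes "v $ 1 = 0" and "v \<noteq> 0"
  shows "perp v \<in> osculating_planes h \<longleftrightarrow> v $ 2 = 0 \<and> v $ 3 = 0"
proof
  assume "perp v \<in> osculating_planes h"
  then obtain u w where "u \<noteq> 0 \<or> w \<noteq> 0" "perp v = perp (arcv u w)"
    by (auto simp: osculating_eq)
  then obtain c where "arcv u w = c *s v"
    using perp_eq_iff[of v "arcv u w"] assms(2) by auto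
  then show "v $ 2 = 0 \<and> v $ 3 = 0"
    using assms(1) \<open>u \<noteq> 0 \<or> w \<noteq> 0\<close> by (auto simp: vec4_eq_iff arcv_nth)
next
  assume *: "v $ 2 = 0 \<and> v $ 3 = 0"
  then have "v = (v $ 4) *s arcv 0 1"
    using assms(1) by (simp add: vec4_eq_iff arcv_nth)
  moreover from this have "v $ 4 \<noteq> 0"
    using assms(2) by (metis vec.scale_zero_left)
  ultimately have "perp v = perp (arcv 0 1)"
    using perp_scale by metis
  then show "perp v \<in> osculating_planes h"
    unfolding osculating_eq by force
qed

lemma osculating_gmat:
  assumes "a * d + b * c = 1"
  shows "perp (gmat a b c d *v v) \<in> osculating_planes h \<longleftrightarrow> perp v \<in> osculating_planes h"
proof -
  have preserve: "perp (gmat a b c d *v v) \<in> osculating_planes h"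
    if g: "a * d + b * c = 1" and v: "perp v \<in> osculating_planes h" for a b c d v
  proof -
    obtain u w where uw: "u \<noteq> 0 \<or> w \<noteq> 0" "perp v = perp (arcv u w)"
      using v by (auto simp: osculating_eq)
    have "gmat a b c d *v arcv u w \<noteq> 0"
      using uw(1) gmat_inverse(1)[OF g, of "arcv u w"] by auto
    moreover have "perp (gmat a b c d *v v) = perp (gmat a b c d *v arcv u w)"
      by (simp add: perp_gmat[OF g] uw(2))
    ultimately show ?thesis
      unfolding osculating_eq gmat_arcv by auto
  qed
  show ?thesis
    using preserve[of a d b c v] preserve[of d a b c "gmat a b c d *v v"] assms
    by (auto simp: gmat_inverse mult.commute)
qed

lemma move_arc_point:
  assumes "u \<noteq> 0 \<or> w \<noteq> 0"
  obtains a b c d k where "a * d + b * c = 1" and "k \<noteq> 0" and "gmat a b c d *v arcv u w = arcv 0 k"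
proof (cases "w = 0")
  case True
  have "0 * 0 + (1::'a) * 1 = 1" "u \<noteq> 0" "gmat 0 1 1 0 *v arcv u w = arcv 0 u"
    using True assms by (simp_all add: gmat_arcv)
  then show ?thesis
    using that by blast
next
  case False
  \<comment> \<open>The first row \<open>(w, u)\<close> annihilates \<open>(u, w)\<close> in
    characteristic 2; the second row is chosen to give determinant 1.\<close>
  have "w * (1 / w) + u * 0 = 1" "1 \<noteq> (0::'a)" "gmat w u 0 (1 / w) *v arcv u w = arcv 0 1"
    using False by (simp_all add: gmat_arcv mult.commute)
  then show ?thesis
    using that by blast
qed

lemma move_plane_to_U4:
  fixes v :: "'a ^ 4"
  assumes "v \<noteq> 0" and "arc_pts_on h (perp v) \<noteq> {}"
  obtains v' where "v' \<noteq> 0" and "v' $ 1 = 0" and "arc_equiv h (perp v) (perp v')"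
    and "perp v' \<in> osculating_planes h \<longleftrightarrow> perp v \<in> osculating_planes h"
proof -
  obtain u w where uw: "u \<noteq> 0 \<or> w \<noteq> 0" and on: "pt (arcv u w) \<subseteq> perp v"
    using assms(2) unfolding arc_pts_on_def arc_eq by blast
  obtain a b c d k where g: "a * d + b * c = 1" "k \<noteq> 0" "gmat a b c d *v arcv u w = arcv 0 k"
    using move_arc_point[OF uw] by metis
  let ?v = "gmat a b c d *v v"
  have "symp_form ?v (arcv 0 k) = 0"
    using on symp_gmat[OF g(1), of v "arcv u w"] by (simp add: pt_subset_perp g(3))
  then have "?v $ 1 = 0"
    using g(2) by (simp add: symp_form_def arcv_nth)
  moreover have "?v \<noteq> 0"
    using assms(1) gmat_inverse(1)[OF g(1), of v] by auto
  ultimately show ?thesis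
    using that equiv_gmat[OF g(1)] osculating_gmat[OF g(1)] by blast
qed

text \<open>The matrix \<open>gmat 1 0 t 1\<close> fixes \<open>U4\<close> and translates the
  parameters of the other arc points by \<open>t\<close>, so the constant term changes by a value of
  the additive part.\<close>

lemma shift_plane:
  fixes v :: "'a ^ 4"
  assumes "v $ 1 = 0"
  shows "arc_equiv h (perp v)
    (perp (vector [0, v $ 2, v $ 3, v $ 4 + (v $ 2 * s t + v $ 3 * t)]))"
proof -
  have "gmat 1 0 t 1 *v v = vector [0, v $ 2, v $ 3, v $ 4 + (v $ 2 * s t + v $ 3 * t)]"
    using assms by (simp add: vec4_eq_iff gmat_nth vector_4_nth algebra_simps)
  then show ?thesis
    using equiv_gmat[of 1 1 0 t v] by simp
qed

text \<open>Translating the root to 0 removes the constant term. If the remaining coordinate is the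
  third, \<open>gmat 0 1 1 0\<close>, which interchanges the two middle coordinates, brings it to
  the second.\<close>

lemma two_point_rep:
  fixes v :: "'a ^ 4"
  assumes "v $ 1 = 0" and "(v $ 2 = 0) \<noteq> (v $ 3 = 0)"
  shows "arc_equiv h (perp v) (perp (vector [0, 1, 0, 0]))"
proof -
  obtain t where "v $ 2 * s t + v $ 3 * t + v $ 4 = 0"
    using affine_roots_one[of "v $ 2" "v $ 3" "v $ 4"] assms(2)
    by (metis (mono_tags, lifting) card_1_singletonE mem_Collect_eq singletonI)
  then have "arc_equiv h (perp v) (perp (vector [0, v $ 2, v $ 3, 0]))"
    using shift_plane[OF assms(1), of t] by (simp add: add.commute)
  moreover have "arc_equiv h (perp (vector [0, v $ 2, v $ 3, 0])) (perp (vector [0, 1, 0, 0]))"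
  proof (cases "v $ 3 = 0")
    case True
    have "vector [0, v $ 2, v $ 3, 0] = (v $ 2) *s (vector [0, 1, 0, 0] :: 'a ^ 4)"
      using True by (simp add: vec4_eq_iff vector_4_nth)
    then show ?thesis
      using perp_scale[of "v $ 2"] arc_equiv_refl True assms(2) by metis
  next
    case False
    then have "gmat 0 1 1 0 *v vector [0, v $ 2, v $ 3, 0] = (v $ 3) *s (vector [0, 1, 0, 0] :: 'a ^ 4)"
      using assms(2) by (simp add: vec4_eq_iff vector_4_nth gmat_nth)
    then show ?thesis
      using equiv_gmat[of 0 0 1 1 "vector [0, v $ 2, v $ 3, 0]"] perp_scale[OF False]
      by (metis add_0_left mult_1 mult_zero_left)
  qed
  ultimately show ?thesis
    by (rule arc_equiv_trans)
qed

text \<open>A diagonal matrix multiplies the middle coordinates by \<open>s x / x\<close> and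
  \<open>x / s x\<close>; the choice of \<open>x\<close> makes both equal to \<open>?k\<close>,
  which is then scaled to 1.\<close>

lemma balanced_rep:
  fixes v :: "'a ^ 4"
  assumes "v $ 1 = 0" and "v $ 2 \<noteq> 0" and "v $ 3 \<noteq> 0"
  obtains a where "arc_equiv h (perp v) (perp (vector [0, 1, 1, a]))"
proof -
  obtain x where x: "x \<noteq> 0" "(s x / x)\<^sup>2 = v $ 3 / v $ 2"
    using s_ratio_obtain[of "v $ 3 / v $ 2"] assms by auto
  let ?k = "s x / x * v $ 2" and ?a = "v $ 4 / (s x * x)"
  have k: "?k \<noteq> 0" "v $ 3 * x / s x = ?k"
    using x assms by (simp_all add: field_simps power2_eq_square)
  have "gmat x 0 0 (1 / x) *v v = ?k *s vector [0, 1, 1, ?a / ?k]"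
    using assms k x(1) by (simp add: vec4_eq_iff vector_4_nth gmat_nth s_divide field_simps)
  moreover have "x * (1 / x) + 0 * 0 = 1"
    using x(1) by simp
  ultimately show ?thesis
    using that equiv_gmat perp_scale[OF k(1)] by metis
qed

lemma three_point_rep:
  fixes v :: "'a ^ 4"
  assumes "v $ 1 = 0" and "v $ 2 \<noteq> 0" and "v $ 3 \<noteq> 0" and "card (arc_pts_on h (perp v)) = 3"
  shows "arc_equiv h (perp v) (perp (vector [0, 1, 1, 0]))"
proof -
  obtain a where a: "arc_equiv h (perp v) (perp (vector [0, 1, 1, a]))"
    using balanced_rep assms by metis
  let ?v = "vector [0, 1, 1, a] :: 'a ^ 4"
  have v: "?v $ 1 = 0" "?v $ 2 = 1" "?v $ 3 = 1" "?v $ 4 = a" "?v \<noteq> 0"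
    by (simp_all add: vector_4_nth vec4_eq_iff)
  have "card (arc_pts_on h (perp ?v)) = 3"
    using arc_equiv_card[OF a] assms(4) by simp
  then obtain t where "s t + t + a = 0"
    using card_arc_pts_on_cases(4)[of ?v] v by force
  then show ?thesis
    using arc_equiv_trans[OF a shift_plane[OF v(1), of t]] by (simp add: v add.commute)
qed

text \<open>In the normal form \<open>[0, 1, 1, a]\<close> having one arc point means that
  \<open>a\<close> lies outside the image of \<open>t \<mapsto> s t + t\<close>. This image has
  index 2, so two such \<open>a\<close> differ by an element of it, that is, by a
  translation.\<close>

lemma one_point_equiv:
  fixes v w :: "'a ^ 4"
  assumes "v $ 1 = 0" "v $ 2 \<noteq> 0" "v $ 3 \<noteq> 0" "card (arc_pts_on h (perp v)) = 1"
    and "w $ 1 = 0" "w $ 2 \<noteq> 0" "w $ 3 \<noteq> 0" "card (arc_pts_on h (perp w)) = 1"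
  shows "arc_equiv h (perp v) (perp w)"
proof -
  let ?v = "\<lambda>a. vector [0, 1, 1, a] :: 'a ^ 4"
  have v: "?v a $ 1 = 0" "?v a $ 2 = 1" "?v a $ 3 = 1" "?v a $ 4 = a" "?v a \<noteq> 0" for a
    by (simp_all add: vector_4_nth vec4_eq_iff)
  let ?I = "{a. \<exists>t. s t + t + a = 0}" and ?N = "{a. \<nexists>t. s t + t + a = 0}"
  have not_image: "a \<in> ?N" if "card (arc_pts_on h (perp (?v a))) = 1" for a
    using that card_arc_pts_on_cases(3)[of "?v a"] v by force
  obtain a where a: "arc_equiv h (perp v) (perp (?v a))"
    using balanced_rep assms by metis
  obtain b where b: "arc_equiv h (perp w) (perp (?v b))"
    using balanced_rep assms by metis
  have "a \<in> ?N" "b \<in> ?N"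
    using not_image arc_equiv_card[OF a] arc_equiv_card[OF b] assms(4,8) by simp_all
  \<comment> \<open>The translate of the image by \<open>a\<close> avoids the image and has half of
    all scalars, hence is the whole complement.\<close>
  have "(+) a ` ?I \<subseteq> ?N"
  proof
    fix z assume "z \<in> (+) a ` ?I"
    then obtain y where z: "z = a + y" and "y \<in> ?I"
      by (elim imageE) (rule that)
    then obtain t where y: "s t + t + y = 0"
      by blast
    have "s t' + t' + z \<noteq> 0" for t'
    proof
      assume "s t' + t' + z = 0"
      moreover have "s (t + t') + (t + t') + a = (s t + t + y) + (s t' + t' + z)"
        unfolding z s_add by (simp add: ac_simps)
      ultimately have "s (t + t') + (t + t') + a = 0"
        by (simp only: y add_0_left)
      then show False
        using \<open>a \<in> ?N\<close> by blast
    qed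
    then show "z \<in> ?N"
      by blast
  qed
  moreover have "card ((+) a ` ?I) = card ?N"
    using card_affine_image[of 1 1] by (simp add: card_image)
  ultimately have "(+) a ` ?I = ?N"
    by (intro card_subset_eq) auto
  with \<open>b \<in> ?N\<close> have "b \<in> (+) a ` ?I"
    by (simp only:)
  then obtain y where "b = a + y" "y \<in> ?I"
    by (elim imageE) (rule that)
  then obtain t where "b = a + (s t + t)"
    by (auto simp: add_eq_0_iff_eq)
  then have "arc_equiv h (perp (?v a)) (perp (?v b))"
    using shift_plane[OF v(1), of a t] by (simp add: v)
  then show ?thesis
    using a b arc_equiv_sym arc_equiv_trans by blast
qed

section \<open>Intrinsic recognition of the osculating planes\<close>

lemma U4_on_perp: "pt (arcv 0 1) \<in> arc_pts_on h (perp v) \<longleftrightarrow> v $ 1 = 0"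
  by (simp add: arc_pts_on_def arc_eq_insert pt_subset_perp symp_form_def arcv_nth)

lemma arc_pts_on_singleton:
  fixes v :: "'a ^ 4"
  assumes "v $ 1 = 0" and "card (arc_pts_on h (perp v)) = 1"
  shows "arc_pts_on h (perp v) = {pt (arcv 0 1)}"
  using assms U4_on_perp[of v] by (metis card_1_singletonE singletonD)

lemma vector_0_neq: "b \<noteq> 0 \<or> c \<noteq> 0 \<Longrightarrow> vector [0, b, c, a] \<noteq> (0 :: 'a ^ 4)"
  by (auto simp: vec4_eq_iff vector_4_nth)

text \<open>Consider the pencil spanned by \<open>v\<close> and a two-point plane \<open>r\<close>
  through \<open>U4\<close>, where exactly one middle coordinate of \<open>r\<close> is nonzero. If
  \<open>v\<close> is osculating, adding multiples of it affects only the last coordinate, so all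
  other planes of the pencil keep two points. If both middle coordinates of \<open>v\<close> are
  nonzero, some other plane of a suitable pencil has 1 or 3 points.\<close>

lemma tangential_U4_iff:
  fixes v :: "'a ^ 4"
  assumes v1: "v $ 1 = 0" and v: "v \<noteq> 0"
  shows "tangential h (perp v) \<longleftrightarrow> v $ 2 = 0 \<and> v $ 3 = 0"
proof
  assume tan: "tangential h (perp v)"
  then have one: "card (arc_pts_on h (perp v)) = 1"
    by (simp add: tangential_def)
  then have eq: "v $ 2 = 0 \<longleftrightarrow> v $ 3 = 0"
    using card_arc_pts_on_cases(2)[OF assms] by fastforce
  show "v $ 2 = 0 \<and> v $ 3 = 0"
  proof (rule ccontr)
    assume "\<not> (v $ 2 = 0 \<and> v $ 3 = 0)"
    then have nz: "v $ 2 \<noteq> 0" "v $ 3 \<noteq> 0"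
      using eq by auto
    have "\<not> UNIV \<subseteq> {0, 1::'a}"
      using card_gt_2 card_mono[of "{0, 1::'a}" UNIV] by auto
    then obtain k :: 'a where k: "k \<noteq> 0" "k \<noteq> 1"
      by blast
    define r where "r = (vector [0, 0, 1, 0] :: 'a ^ 4)"
    \<comment> \<open>This is \<open>v\<close> plus a multiple of \<open>r\<close>, so it contains
      the common line; \<open>k \<noteq> 0\<close> keeps both middle coordinates nonzero and
      \<open>k \<noteq> 1\<close> makes the plane differ from that of \<open>v\<close>.\<close>
    define t where "t = (vector [0, v $ 2, k * v $ 3, v $ 4] :: 'a ^ 4)"
    have r: "r $ 1 = 0" "r $ 2 = 0" "r $ 3 = 1" "r $ 4 = 0" "r \<noteq> 0"
      by (simp_all add: r_def vector_4_nth vector_0_neq)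
    have t: "t $ 1 = 0" "t $ 2 = v $ 2" "t $ 3 = k * v $ 3" "t $ 4 = v $ 4" "t \<noteq> 0"
      using nz by (simp_all add: t_def vector_4_nth vector_0_neq)
    have "card (arc_pts_on h (perp r)) = 2"
      using card_arc_pts_on_cases(2)[of r] r by simp
    moreover have "arc_pts_on h (perp v) \<subseteq> arc_pts_on h (perp r)"
      unfolding arc_pts_on_singleton[OF v1 one] using r(1) U4_on_perp by simp
    moreover have "perp v \<inter> perp r \<subseteq> perp t"
      using v1 by (auto simp: perp_def symp_form_def r t)
    moreover have "perp t \<noteq> perp v"
    proof
      assume "perp t = perp v"
      then obtain c where "t = c *s v"
        using perp_eq_iff[OF v t(5)] by auto
      then show False
        using nz k(2) t by (auto simp: vec4_eq_iff)
    qed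
    ultimately have "card (arc_pts_on h (perp t)) = 2"
      using tan perp_in_planes[OF r(5)] perp_in_planes[OF t(5)] unfolding tangential_def by blast
    then show False
      using card_arc_pts_on_cases(3,4)[of t] t nz k(1) by fastforce
  qed
next
  assume v23: "v $ 2 = 0 \<and> v $ 3 = 0"
  then have v4: "v $ 4 \<noteq> 0"
    using v v1 by (auto simp: vec4_eq_iff)
  have one: "card (arc_pts_on h (perp v)) = 1"
    using card_arc_pts_on_cases(1)[OF assms] v23 by simp
  have "card (arc_pts_on h \<tau>) = 2"
    if "\<rho> \<in> pg_planes" "card (arc_pts_on h \<rho>) = 2" "\<tau> \<in> pg_planes"
      "arc_pts_on h (perp v) \<subseteq> arc_pts_on h \<rho>" "perp v \<inter> \<rho> \<subseteq> \<tau>" "\<tau> \<noteq> perp v"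
    for \<rho> \<tau>
  proof -
    obtain r where r: "r \<noteq> 0" "\<rho> = perp r"
      using \<open>\<rho> \<in> pg_planes\<close> by (rule plane_obtain)
    obtain t where t: "t \<noteq> 0" "\<tau> = perp t"
      using \<open>\<tau> \<in> pg_planes\<close> by (rule plane_obtain)
    have r1: "r $ 1 = 0"
      using that(4) U4_on_perp[of v] U4_on_perp[of r] v1 r(2) by blast
    have r23: "(r $ 2 = 0) \<noteq> (r $ 3 = 0)"
      using that(2) card_arc_pts_on_cases[OF r1 r(1)] unfolding r(2) by fastforce
    have sub: "symp_form t y = 0" if "y $ 1 = 0" "symp_form r y = 0" for y
    proof -
      have "y \<in> perp v \<inter> \<rho>"
        using that v1 v23 by (simp add: perp_def r(2) symp_form_def)
      then show ?thesis
        using \<open>perp v \<inter> \<rho> \<subseteq> \<tau>\<close> by (auto simp: perp_def t(2))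
    qed
    have t1: "t $ 1 = 0"
      using sub[of "axis 4 1"] r1 by (simp add: symp_form_def axis_def)
    have "t $ 2 = 0 \<or> t $ 3 = 0"
      using sub[of "axis 2 1"] sub[of "axis 3 1"] r1 r23 by (auto simp: symp_form_def axis_def)
    moreover have "\<not> (t $ 2 = 0 \<and> t $ 3 = 0)"
    proof
      assume "t $ 2 = 0 \<and> t $ 3 = 0"
      then have "t = (t $ 4 / v $ 4) *s v" "t $ 4 / v $ 4 \<noteq> 0"
        using v1 v23 v4 t1 t(1) by (auto simp: vec4_eq_iff)
      then show False
        using \<open>\<tau> \<noteq> perp v\<close> t(2) perp_scale by metis
    qed
    ultimately show ?thesis
      using card_arc_pts_on_cases(2)[OF t1 t(1)] t(2) by blast
  qed
  then show "tangential h (perp v)"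
    unfolding tangential_def using one by blast
qed

lemma osculating_subset_planes: "osculating_planes h \<subseteq> (pg_planes :: ('a ^ 4) set set)"
  unfolding osculating_eq by (auto intro!: perp_in_planes)

lemma osculating_arc_pts_nonempty:
  assumes "\<pi> \<in> osculating_planes h"
  shows "arc_pts_on h (\<pi> :: ('a ^ 4) set) \<noteq> {}"
proof -
  obtain u w where uw: "u \<noteq> 0 \<or> w \<noteq> 0" "\<pi> = perp (arcv u w)"
    using assms by (auto simp: osculating_eq)
  have "symp_form (arcv u w) (arcv u w) = 0"
    by (simp add: symp_form_def mult.commute)
  then have "pt (arcv u w) \<in> arc_pts_on h \<pi>"
    using uw by (auto simp: arc_pts_on_def arc_eq pt_subset_perp simp del: subset_iff)
  then show ?thesis
    by blast
qed

text \<open>Tangentiality is invariant under the full stabiliser, osculation so far only under the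
  matrices \<open>gmat\<close>; moving the plane to \<open>U4\<close> by such a matrix preserves
  both.\<close>

lemma osculating_iff_tangential:
  assumes "\<pi> \<in> (pg_planes :: ('a ^ 4) set set)"
  shows "\<pi> \<in> osculating_planes h \<longleftrightarrow> tangential h \<pi>"
proof (cases "arc_pts_on h \<pi> = {}")
  case True
  then show ?thesis
    using osculating_arc_pts_nonempty[of \<pi>] by (auto simp: tangential_def)
next
  case False
  obtain v where v: "v \<noteq> 0" "\<pi> = perp v"
    using assms by (rule plane_obtain)
  obtain v' where v': "v' \<noteq> 0" "v' $ 1 = 0" "arc_equiv h \<pi> (perp v')"
      "perp v' \<in> osculating_planes h \<longleftrightarrow> \<pi> \<in> osculating_planes h"
    using move_plane_to_U4[OF v(1)] False unfolding v(2) by metis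
  show ?thesis
    using v'(4) tangential_equiv[OF v'(3)] tangential_U4_iff[OF v'(2,1)] osculating_iff[OF v'(2,1)]
    by simp
qed

lemma equiv_plane: "arc_equiv h \<pi> \<rho> \<Longrightarrow> \<pi> \<in> pg_planes \<Longrightarrow> \<rho> \<in> pg_planes"
  using mat_image_plane by (auto simp: arc_equiv_def arc_stab_def)

lemma equiv_osculating:
  assumes "arc_equiv h \<pi> \<rho>" and "\<pi> \<in> (pg_planes :: ('a ^ 4) set set)"
  shows "\<rho> \<in> osculating_planes h \<longleftrightarrow> \<pi> \<in> osculating_planes h"
  using osculating_iff_tangential assms equiv_plane tangential_equiv by metis

lemma osculating_one_point:
  "\<pi> \<in> osculating_planes h \<Longrightarrow> card (arc_pts_on h (\<pi> :: ('a ^ 4) set)) = 1"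
  using osculating_iff_tangential osculating_subset_planes by (auto simp: tangential_def)

text \<open>Osculating planes carry exactly one arc point and would otherwise merge with the class
  \<open>k = 1\<close>.\<close>

definition plane_class :: "nat \<Rightarrow> ('a ^ 4) set set" where
  "plane_class k = {\<pi> \<in> pg_planes - osculating_planes h. card (arc_pts_on h \<pi>) = k}"

lemma equiv_plane_class:
  assumes "arc_equiv h \<pi> \<rho>" and "\<pi> \<in> pg_planes"
  shows "\<rho> \<in> plane_class k \<longleftrightarrow> \<pi> \<in> plane_class k"
  using equiv_osculating[OF assms] equiv_plane[OF assms] arc_equiv_card[OF assms(1)] assms(2)
  by (simp add: plane_class_def)

lemma plane_class_U4_iff:
  fixes v :: "'a ^ 4"
  assumes "v $ 1 = 0" and "v \<noteq> 0"
  shows "perp v \<in> plane_class 1 \<longleftrightarrow>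
      v $ 2 \<noteq> 0 \<and> v $ 3 \<noteq> 0 \<and> (\<nexists>t. v $ 2 * s t + v $ 3 * t + v $ 4 = 0)"
    and "perp v \<in> plane_class 2 \<longleftrightarrow> (v $ 2 = 0) \<noteq> (v $ 3 = 0)"
    and "perp v \<in> plane_class 3 \<longleftrightarrow>
      v $ 2 \<noteq> 0 \<and> v $ 3 \<noteq> 0 \<and> (\<exists>t. v $ 2 * s t + v $ 3 * t + v $ 4 = 0)"
proof -
  let ?root = "\<exists>t. v $ 2 * s t + v $ 3 * t + v $ 4 = 0"
  have card: "card (arc_pts_on h (perp v)) =
      (if v $ 2 = 0 \<and> v $ 3 = 0 then 1 else if v $ 2 = 0 \<or> v $ 3 = 0 then 2
       else if ?root then 3 else 1)"
    using card_arc_pts_on_cases[OF assms] by presburger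
  have iff: "perp v \<in> plane_class k \<longleftrightarrow> \<not> (v $ 2 = 0 \<and> v $ 3 = 0) \<and> card (arc_pts_on h (perp v)) = k" for k
    using osculating_iff[OF assms] perp_in_planes[OF assms(2)] by (simp add: plane_class_def)
  show "perp v \<in> plane_class 1 \<longleftrightarrow> v $ 2 \<noteq> 0 \<and> v $ 3 \<noteq> 0 \<and> \<not> ?root"
    and "perp v \<in> plane_class 2 \<longleftrightarrow> (v $ 2 = 0) \<noteq> (v $ 3 = 0)"
    and "perp v \<in> plane_class 3 \<longleftrightarrow> v $ 2 \<noteq> 0 \<and> v $ 3 \<noteq> 0 \<and> ?root"
    unfolding iff card by (cases "v $ 2 = 0"; cases "v $ 3 = 0"; cases ?root; simp only: ; simp)+
qed

lemma plane_at_U4: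
  assumes "\<pi> \<in> (pg_planes :: ('a ^ 4) set set)" and "card (arc_pts_on h \<pi>) \<noteq> 0"
  obtains v where "v \<noteq> 0" and "v $ 1 = 0" and "arc_equiv h \<pi> (perp v)"
proof -
  obtain v where v: "v \<noteq> 0" "\<pi> = perp v"
    using assms(1) by (rule plane_obtain)
  moreover have "arc_pts_on h (perp v) \<noteq> {}"
    using assms(2) v(2) by auto
  ultimately show ?thesis
    using move_plane_to_U4 that by metis
qed

lemma planes_eq:
  "(pg_planes :: ('a ^ 4) set set) =
     osculating_planes h \<union> plane_class 0 \<union> plane_class 1 \<union> plane_class 2 \<union> plane_class 3"
proof
  show "pg_planes \<subseteq>
     osculating_planes h \<union> plane_class 0 \<union> plane_class 1 \<union> plane_class 2 \<union> plane_class 3"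
  proof
    fix \<pi> :: "('a ^ 4) set" assume \<pi>: "\<pi> \<in> pg_planes"
    show "\<pi> \<in> osculating_planes h \<union> plane_class 0 \<union> plane_class 1 \<union> plane_class 2 \<union> plane_class 3"
    proof (cases "card (arc_pts_on h \<pi>) = 0")
      case True
      then show ?thesis
        using \<pi> by (simp add: plane_class_def)
    next
      case False
      then obtain v where v: "v \<noteq> 0" "v $ 1 = 0" "arc_equiv h \<pi> (perp v)"
        using plane_at_U4 \<pi> by metis
      have "perp v \<in> osculating_planes h \<union> plane_class 1 \<union> plane_class 2 \<union> plane_class 3"
        using plane_class_U4_iff[OF v(2,1)] osculating_iff[OF v(2,1)] by blast
      then show ?thesis
        using equiv_plane_class[OF v(3) \<pi>] equiv_osculating[OF v(3) \<pi>] by blast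
    qed
  qed
qed (use osculating_subset_planes in \<open>auto simp: plane_class_def\<close>)

section \<open>Transitivity on the planes that meet the arc\<close>

lemma osculating_transitive:
  assumes "\<pi> \<in> osculating_planes h" and "\<rho> \<in> osculating_planes h"
  shows "arc_equiv h \<pi> (\<rho> :: ('a ^ 4) set)"
proof -
  have rep: "arc_equiv h \<pi> (perp (arcv 0 1))" if \<pi>: "\<pi> \<in> osculating_planes h" for \<pi> :: "('a ^ 4) set"
  proof -
    obtain u w where uw: "u \<noteq> 0 \<or> w \<noteq> 0" "\<pi> = perp (arcv u w)"
      using \<pi> by (auto simp: osculating_eq)
    obtain a b c d k where g: "a * d + b * c = 1" "k \<noteq> 0" "gmat a b c d *v arcv u w = arcv 0 k"
      using move_arc_point[OF uw(1)] by metis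
    have "perp (arcv 0 k) = perp (arcv 0 1)"
      using arcv_scale[of k 0 1] perp_scale[of "s k * k" "arcv 0 1"] g(2) by simp
    then show ?thesis
      using equiv_gmat[OF g(1), of "arcv u w"] g(3) uw(2) by simp
  qed
  show ?thesis
    using rep[OF assms(1)] rep[OF assms(2)] arc_equiv_sym arc_equiv_trans by blast
qed

lemma plane_class_transitive:
  assumes "k \<in> {1, 2, 3}" and "\<pi> \<in> plane_class k" and "\<rho> \<in> plane_class k"
  shows "arc_equiv h \<pi> \<rho>"
proof -
  have planes: "\<pi> \<in> pg_planes" "\<rho> \<in> pg_planes"
      and card: "card (arc_pts_on h \<pi>) = k" "card (arc_pts_on h \<rho>) = k"
    using assms(2,3) by (simp_all add: plane_class_def)
  have k0: "k \<noteq> 0"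
    using assms(1) by auto
  obtain v where v: "v \<noteq> 0" "v $ 1 = 0" "arc_equiv h \<pi> (perp v)"
    using plane_at_U4[OF planes(1)] card(1) k0 by metis
  obtain w where w: "w \<noteq> 0" "w $ 1 = 0" "arc_equiv h \<rho> (perp w)"
    using plane_at_U4[OF planes(2)] card(2) k0 by metis
  have classes: "perp v \<in> plane_class k" "perp w \<in> plane_class k"
    using equiv_plane_class v(3) w(3) planes assms by blast+
  then have cards: "card (arc_pts_on h (perp v)) = k" "card (arc_pts_on h (perp w)) = k"
    by (auto simp: plane_class_def)
  have "arc_equiv h (perp v) (perp w)"
    using assms(1)
  proof (elim insertE)
    assume "k = 1"
    then show ?thesis
      using one_point_equiv[OF v(2) _ _ _ w(2)] classes cards
      by (simp add: plane_class_U4_iff(1)[OF v(2,1)] plane_class_U4_iff(1)[OF w(2,1)]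
          del: One_nat_def)
  next
    assume "k = 2"
    then have "arc_equiv h (perp v) (perp (vector [0, 1, 0, 0]))" "arc_equiv h (perp w) (perp (vector [0, 1, 0, 0]))"
      using two_point_rep[OF v(2)] two_point_rep[OF w(2)] classes
      by (simp_all add: plane_class_U4_iff(2)[OF v(2,1)] plane_class_U4_iff(2)[OF w(2,1)])
    then show ?thesis
      using arc_equiv_sym arc_equiv_trans by blast
  next
    assume "k = 3"
    then have "arc_equiv h (perp v) (perp (vector [0, 1, 1, 0]))" "arc_equiv h (perp w) (perp (vector [0, 1, 1, 0]))"
      using three_point_rep[OF v(2)] three_point_rep[OF w(2)] classes cards
      by (simp_all add: plane_class_U4_iff(3)[OF v(2,1)] plane_class_U4_iff(3)[OF w(2,1)])
    then show ?thesis
      using arc_equiv_sym arc_equiv_trans by blast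
  qed simp
  then show ?thesis
    using v(3) w(3) arc_equiv_sym arc_equiv_trans by blast
qed
section \<open>Numbers of planes\<close>

lemma card_vectors_U4:
  "card {v :: 'a ^ 4. v $ 1 = 0 \<and> P (v $ 2) (v $ 3) (v $ 4)} = card {(b, c, a). P b c a}"
proof -
  have "bij_betw (\<lambda>(b, c, a). vector [0, b, c, a] :: 'a ^ 4) {(b, c, a). P b c a}
    {v. v $ 1 = 0 \<and> P (v $ 2) (v $ 3) (v $ 4)}"
    by (rule bij_betwI[of _ _ _ "\<lambda>v. (v $ 2, v $ 3, v $ 4)"])
      (auto simp: vector_4_nth vec4_eq_iff)
  then show ?thesis
    by (rule bij_betw_same_card[symmetric])
qed

lemma card_balanced_triples:
  assumes "\<And>b c. b \<noteq> 0 \<Longrightarrow> c \<noteq> 0 \<Longrightarrow> 2 * card {a. P b c a} = CARD('a)"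
  shows "2 * card {(b::'a, c::'a, a::'a). b \<noteq> 0 \<and> c \<noteq> 0 \<and> P b c a} = (CARD('a) - 1)\<^sup>2 * CARD('a)"
proof -
  have "{(b::'a, c::'a, a::'a). b \<noteq> 0 \<and> c \<noteq> 0 \<and> P b c a} =
      (SIGMA b:UNIV - {0}. SIGMA c:UNIV - {0}. {a. P b c a})"
    by auto
  then have "2 * card {(b::'a, c::'a, a::'a). b \<noteq> 0 \<and> c \<noteq> 0 \<and> P b c a} =
      (\<Sum>b\<in>UNIV - {0::'a}. \<Sum>c\<in>UNIV - {0::'a}. 2 * card {a. P b c a})"
    by (simp add: sum_distrib_left)
  also have "\<dots> = (\<Sum>b\<in>UNIV - {0::'a}. \<Sum>c\<in>UNIV - {0::'a}. CARD('a))"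
    by (intro sum.cong refl assms) auto
  also have "\<dots> = (CARD('a) - 1)\<^sup>2 * CARD('a)"
    by (simp add: card_Diff_subset power2_eq_square)
  finally show ?thesis .
qed

definition class_vectors :: "nat \<Rightarrow> ('a ^ 4) set" where
  "class_vectors k = {v. v \<noteq> 0 \<and> perp v \<in> plane_class k}"

text \<open>For nonzero middle coordinates, half of the constant terms give an equation with roots
  (class 3) and half give one without (class 1).\<close>

lemma card_class_vectors_U4:
  shows "2 * card {v \<in> class_vectors 1. v $ 1 = 0} = (CARD('a) - 1)\<^sup>2 * CARD('a)"
    and "card {v \<in> class_vectors 2. v $ 1 = 0} = 2 * (CARD('a) - 1) * CARD('a)"
    and "2 * card {v \<in> class_vectors 3. v $ 1 = 0} = (CARD('a) - 1)\<^sup>2 * CARD('a)"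
proof -
  have "{v \<in> class_vectors 1. v $ 1 = 0} = {v. v $ 1 = 0 \<and>
      (v $ 2 \<noteq> 0 \<and> v $ 3 \<noteq> 0 \<and> (\<nexists>t. v $ 2 * s t + v $ 3 * t + v $ 4 = 0))}"
    by (rule Collect_cong, rename_tac v, case_tac "v = 0"; case_tac "v $ 1 = 0")
      (simp_all add: class_vectors_def plane_class_U4_iff(1) del: One_nat_def)
  then have "card {v \<in> class_vectors 1. v $ 1 = 0} =
      card {(b, c, a). b \<noteq> 0 \<and> c \<noteq> 0 \<and> (\<nexists>t. b * s t + c * t + a = 0)}"
    by (simp only: card_vectors_U4[of "\<lambda>b c a. b \<noteq> 0 \<and> c \<noteq> 0 \<and> (\<nexists>t. b * s t + c * t + a = 0)"])
  moreover have "2 * card {(b, c, a). b \<noteq> 0 \<and> c \<noteq> 0 \<and> (\<nexists>t. b * s t + c * t + a = 0)} =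
      (CARD('a) - 1)\<^sup>2 * CARD('a)"
    by (rule card_balanced_triples[of "\<lambda>b c a. \<nexists>t. b * s t + c * t + a = 0"])
      (rule card_affine_image(2))
  ultimately show "2 * card {v \<in> class_vectors 1. v $ 1 = 0} = (CARD('a) - 1)\<^sup>2 * CARD('a)"
    by (simp only:)
  have "{v \<in> class_vectors 3. v $ 1 = 0} = {v. v $ 1 = 0 \<and>
      (v $ 2 \<noteq> 0 \<and> v $ 3 \<noteq> 0 \<and> (\<exists>t. v $ 2 * s t + v $ 3 * t + v $ 4 = 0))}"
    by (rule Collect_cong, rename_tac v, case_tac "v = 0"; case_tac "v $ 1 = 0")
      (simp_all add: class_vectors_def plane_class_U4_iff(3) del: One_nat_def)
  then have "card {v \<in> class_vectors 3. v $ 1 = 0} =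
      card {(b, c, a). b \<noteq> 0 \<and> c \<noteq> 0 \<and> (\<exists>t. b * s t + c * t + a = 0)}"
    by (simp only: card_vectors_U4[of "\<lambda>b c a. b \<noteq> 0 \<and> c \<noteq> 0 \<and> (\<exists>t. b * s t + c * t + a = 0)"])
  moreover have "2 * card {(b, c, a). b \<noteq> 0 \<and> c \<noteq> 0 \<and> (\<exists>t. b * s t + c * t + a = 0)} =
      (CARD('a) - 1)\<^sup>2 * CARD('a)"
    by (rule card_balanced_triples[of "\<lambda>b c a. \<exists>t. b * s t + c * t + a = 0"])
      (rule card_affine_image(1))
  ultimately show "2 * card {v \<in> class_vectors 3. v $ 1 = 0} = (CARD('a) - 1)\<^sup>2 * CARD('a)"
    by (simp only:)
  have "{v \<in> class_vectors 2. v $ 1 = 0} = {v. v $ 1 = 0 \<and> (v $ 2 = 0) \<noteq> (v $ 3 = 0)}"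
    by (rule Collect_cong, rename_tac v, case_tac "v = 0"; case_tac "v $ 1 = 0")
      (simp_all add: class_vectors_def plane_class_U4_iff(2) del: One_nat_def)
  moreover have "{(b::'a, c::'a, a::'a). (b = 0) \<noteq> (c = 0)} =
      {0} \<times> (UNIV - {0}) \<times> UNIV \<union> (UNIV - {0}) \<times> {0} \<times> UNIV"
    by auto
  moreover have "card ({0::'a} \<times> (UNIV - {0::'a}) \<times> (UNIV::'a set) \<union> (UNIV - {0::'a}) \<times> {0::'a} \<times> (UNIV::'a set)) =
      (CARD('a) - 1) * CARD('a) + (CARD('a) - 1) * CARD('a)"
    by (subst card_Un_disjoint) (auto simp: card_cartesian_product card_Diff_subset)
  ultimately show "card {v \<in> class_vectors 2. v $ 1 = 0} = 2 * (CARD('a) - 1) * CARD('a)"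
    using card_vectors_U4[of "\<lambda>b c a. (b = 0) \<noteq> (c = 0)"] by simp
qed

lemma gmat_class_vectors:
  assumes "a * d + b * c = 1"
  shows "gmat a b c d *v v \<in> class_vectors k \<longleftrightarrow> v \<in> class_vectors k"
proof -
  have "gmat a b c d *v v \<noteq> 0 \<longleftrightarrow> v \<noteq> 0"
    using gmat_inverse(1)[OF assms, of v] by auto
  then show ?thesis
    using equiv_plane_class[OF equiv_gmat[OF assms, of v] perp_in_planes]
    by (auto simp: class_vectors_def)
qed

text \<open>Counts incident pairs of an arc point and a class vector. Each vector is in
  \<open>k\<close> pairs; each of the q + 1 arc points is in as many pairs as \<open>U4\<close>,
  because it can be moved there by a matrix that permutes the class vectors.\<close>

lemma double_count_class:
  "k * card (class_vectors k) = (CARD('a) + 1) * card {v \<in> class_vectors k. v $ 1 = 0}"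
proof -
  have "card {v \<in> class_vectors k. P \<subseteq> perp v} = card {v \<in> class_vectors k. v $ 1 = 0}"
    if P: "P \<in> arc h" for P
  proof -
    obtain u w where uw: "u \<noteq> 0 \<or> w \<noteq> 0" "P = pt (arcv u w)"
      using P unfolding arc_eq by blast
    obtain a b c d e where g: "a * d + b * c = 1" "e \<noteq> 0" "gmat a b c d *v arcv u w = arcv 0 e"
      using move_arc_point[OF uw(1)] by metis
    have on: "P \<subseteq> perp v \<longleftrightarrow> (gmat a b c d *v v) $ 1 = 0" for v
    proof -
      have "symp_form v (arcv u w) = symp_form (gmat a b c d *v v) (arcv 0 e)"
        by (simp only: symp_gmat[OF g(1)] flip: g(3))
      also have "\<dots> = (gmat a b c d *v v) $ 1 * (s e * e)"
        by (simp add: symp_form_def arcv_nth)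
      finally show ?thesis
        using g(2) by (simp add: uw(2) pt_subset_perp)
    qed
    have "bij_betw ((*v) (gmat a b c d)) {v \<in> class_vectors k. P \<subseteq> perp v} {v \<in> class_vectors k. v $ 1 = 0}"
    proof (rule bij_betw_imageI)
      show "inj_on ((*v) (gmat a b c d)) {v \<in> class_vectors k. P \<subseteq> perp v}"
        using inj_gmat[OF g(1)] by (rule inj_on_subset) simp
      show "(*v) (gmat a b c d) ` {v \<in> class_vectors k. P \<subseteq> perp v} = {v \<in> class_vectors k. v $ 1 = 0}"
      proof (intro equalityI subsetI)
        fix x assume "x \<in> {v \<in> class_vectors k. v $ 1 = 0}"
        then have "gmat d b c a *v x \<in> {v \<in> class_vectors k. P \<subseteq> perp v}"
          using gmat_class_vectors[OF g(1), of "gmat d b c a *v x"]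
          unfolding mem_Collect_eq on gmat_inverse(2)[OF g(1)] by blast
        then show "x \<in> (*v) (gmat a b c d) ` {v \<in> class_vectors k. P \<subseteq> perp v}"
          using image_eqI[of x "(*v) (gmat a b c d)" "gmat d b c a *v x"] gmat_inverse(2)[OF g(1), of x]
          by simp
      qed (use on gmat_class_vectors[OF g(1)] in fast)
    qed
    then show ?thesis
      by (rule bij_betw_same_card)
  qed
  then have "(\<Sum>v\<in>class_vectors k. card {P \<in> arc h. P \<subseteq> perp v}) =
      card {v \<in> class_vectors k. v $ 1 = 0} * card (arc h :: ('a ^ 4) set set)"
    by (intro sum_multicount) auto
  moreover have "card {P \<in> arc h. P \<subseteq> perp v} = k" if "v \<in> class_vectors k" for v
    using that by (auto simp: class_vectors_def plane_class_def arc_pts_on_def)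
  ultimately show ?thesis
    by (simp add: card_arc mult.commute)
qed

lemma card_plane_class:
  shows "2 * card (plane_class 1) = (CARD('a) + 1) * CARD('a) * (CARD('a) - 1)"
    and "card (plane_class 2) = (CARD('a) + 1) * CARD('a)"
    and "6 * card (plane_class 3) = (CARD('a) + 1) * CARD('a) * (CARD('a) - 1)"
proof -
  \<comment> \<open>Avoids truncated subtraction; \<open>r\<close> is the number of vectors per
    plane and cancels in each count.\<close>
  obtain r where r: "CARD('a) = Suc r" "r > 0"
    using card_gt_2 by (metis Suc_lessD Suc_lessE numeral_2_eq_2)
  have vectors: "card (class_vectors k) = r * card (plane_class k)" for k
    using card_vectors_of_planes[of "plane_class k"] r by (simp add: class_vectors_def plane_class_def)
  note dc = double_count_class[unfolded vectors r(1)] and cv = card_class_vectors_U4[unfolded r(1)]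
  have "r * (2 * card (plane_class 1)) = 2 * (1 * (r * card (plane_class 1)))"
    by simp
  also have "\<dots> = (Suc r + 1) * (2 * card {v \<in> class_vectors 1. v $ 1 = 0})"
    unfolding dc by (simp only: ac_simps)
  also have "\<dots> = r * (Suc (Suc r) * Suc r * r)"
    unfolding cv by (simp add: power2_eq_square algebra_simps)
  finally have "2 * card (plane_class 1) = Suc (Suc r) * Suc r * r \<or> r = 0"
    by (simp only: mult_cancel1)
  then show "2 * card (plane_class 1) = (CARD('a) + 1) * CARD('a) * (CARD('a) - 1)"
    using r by simp
  have "r * (2 * card (plane_class 2)) = 2 * (r * card (plane_class 2))"
    by simp
  also have "\<dots> = (Suc r + 1) * card {v \<in> class_vectors 2. v $ 1 = 0}"
    unfolding dc by (simp only: ac_simps)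
  also have "\<dots> = r * (2 * (Suc (Suc r) * Suc r))"
    unfolding cv by (simp add: power2_eq_square algebra_simps)
  finally have "2 * card (plane_class 2) = 2 * (Suc (Suc r) * Suc r) \<or> r = 0"
    by (simp only: mult_cancel1)
  then show "card (plane_class 2) = (CARD('a) + 1) * CARD('a)"
    using r by simp
  \<comment> \<open>The 6 is 3 arc points per plane times 2, as the count at \<open>U4\<close> is
    known in doubled form.\<close>
  have "r * (6 * card (plane_class 3)) = 2 * (3 * (r * card (plane_class 3)))"
    by simp
  also have "\<dots> = (Suc r + 1) * (2 * card {v \<in> class_vectors 3. v $ 1 = 0})"
    unfolding dc by (simp only: ac_simps)
  also have "\<dots> = r * (Suc (Suc r) * Suc r * r)"
    unfolding cv by (simp add: power2_eq_square algebra_simps)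
  finally have "6 * card (plane_class 3) = Suc (Suc r) * Suc r * r \<or> r = 0"
    by (simp only: mult_cancel1)
  then show "6 * card (plane_class 3) = (CARD('a) + 1) * CARD('a) * (CARD('a) - 1)"
    using r by simp
qed

lemma inj_on_polar_arc: "inj_on polar (arc h :: ('a ^ 4) set set)"
proof (rule inj_onI)
  fix P Q :: "('a ^ 4) set" assume P: "P \<in> arc h" and Q: "Q \<in> arc h" and eq: "polar P = polar Q"
  obtain u w where uw: "u \<noteq> 0 \<or> w \<noteq> 0" "P = pt (arcv u w)"
    using P unfolding arc_eq by blast
  obtain u' w' where uw': "u' \<noteq> 0 \<or> w' \<noteq> 0" "Q = pt (arcv u' w')"
    using Q unfolding arc_eq by blast
  show "P = Q"
    using eq pt_eq_iff_perp[of "arcv u w" "arcv u' w'"] uw uw' by (auto simp: polar_pt_perp)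
qed

lemma card_osculating: "card (osculating_planes h :: ('a ^ 4) set set) = CARD('a) + 1"
  unfolding osculating_planes_def card_image[OF inj_on_polar_arc] by (rule card_arc)

lemma card_planes:
  "card (pg_planes :: ('a ^ 4) set set) = CARD('a) ^ 3 + CARD('a) ^ 2 + CARD('a) + 1"
proof -
  obtain r where r: "CARD('a) = Suc r" "r > 0"
    using card_gt_2 by (metis Suc_lessD Suc_lessE numeral_2_eq_2)
  have "{v :: 'a ^ 4. v \<noteq> 0 \<and> perp v \<in> pg_planes} = UNIV - {0}"
    using perp_in_planes by auto
  then have "r * card (pg_planes :: ('a ^ 4) set set) = Suc r ^ 4 - 1"
    using card_vectors_of_planes[of "pg_planes :: ('a ^ 4) set set"] r(1)
    by (simp add: card_Diff_subset CARD_vec)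
  also have "\<dots> = r * (Suc r ^ 3 + Suc r ^ 2 + Suc r + 1)"
    by (simp add: eval_nat_numeral algebra_simps)
  finally have "card (pg_planes :: ('a ^ 4) set set) = Suc r ^ 3 + Suc r ^ 2 + Suc r + 1 \<or> r = 0"
    by (simp only: mult_cancel1)
  then show ?thesis
    using r by simp
qed

text \<open>By subtraction: removing the osculating planes and class 2 from all planes leaves N =
  \<open>(q + 1) * q * (q - 1)\<close>, of which classes 1 and 3 take N/2 and N/6.\<close>

lemma card_plane_class_0: "3 * card (plane_class 0) = (CARD('a) + 1) * CARD('a) * (CARD('a) - 1)"
proof -
  let ?O = "osculating_planes h :: ('a ^ 4) set set"
  have "card (pg_planes :: ('a ^ 4) set set) = card ?O + card (plane_class 0)
      + card (plane_class 1) + card (plane_class 2) + card (plane_class 3)"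
    unfolding planes_eq by (subst card_Un_disjoint; auto simp: plane_class_def)+
  moreover obtain r where r: "CARD('a) = Suc r"
    using card_gt_2 by (metis Suc_lessD Suc_lessE numeral_2_eq_2)
  ultimately show ?thesis
    using card_plane_class card_planes card_osculating
    by (simp add: eval_nat_numeral algebra_simps)
qed


lemma add_eq_iff: "(x::'a) + y = z \<longleftrightarrow> y = x + z"
  using add_left_cancel[of x "x + y" z] unfolding double_left by (rule sym)

section \<open>Planes without points of the arc\<close>

text \<open>For \<open>g\<close> of determinant 1 the fixed point equation \<open>s(g) X g\<^sup>T = X\<close> becomes
  \<open>s(g) X = X (g\<^sup>T)\<^sup>-\<^sup>1\<close>, and since \<open>g\<^sup>-\<^sup>1\<close> is then the adjugate of \<open>g\<close>, this is additive
  in \<open>g\<close>.\<close>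

definition intertwines :: "'a ^ 4 \<Rightarrow> 'a \<Rightarrow> 'a \<Rightarrow> 'a \<Rightarrow> 'a \<Rightarrow> bool" where
  "intertwines v a b c d \<longleftrightarrow>
     s a * v $ 1 + s b * v $ 3 = d * v $ 1 + b * v $ 2 \<and>
     s a * v $ 2 + s b * v $ 4 = c * v $ 1 + a * v $ 2 \<and>
     s c * v $ 1 + s d * v $ 3 = d * v $ 3 + b * v $ 4 \<and>
     s c * v $ 2 + s d * v $ 4 = c * v $ 3 + a * v $ 4"

lemma intertwines_gmat_fixed:
  assumes det: "a * d + b * c = 1" and fixed: "gmat a b c d *v v = v"
  shows "intertwines v a b c d"
proof -
  let ?g = "gmat a b c d *v v"
  \<comment> \<open>These are the entries of \<open>s(g) X g\<^sup>T\<close> multiplied on the right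
    by the adjugate of \<open>g\<^sup>T\<close>.\<close>
  have "d * ?g $ 1 + b * ?g $ 2 = (a * d + b * c) * (s a * v $ 1 + s b * v $ 3)"
    and "c * ?g $ 1 + a * ?g $ 2 = (a * d + b * c) * (s a * v $ 2 + s b * v $ 4)"
    and "d * ?g $ 3 + b * ?g $ 4 = (a * d + b * c) * (s c * v $ 1 + s d * v $ 3)"
    and "c * ?g $ 3 + a * ?g $ 4 = (a * d + b * c) * (s c * v $ 2 + s d * v $ 4)"
    by (simp_all add: gmat_nth algebra_simps)
  then show ?thesis
    unfolding intertwines_def det fixed by simp
qed

lemma intertwines_add:
  assumes "intertwines v a b c d" and "intertwines v a' b' c' d'"
  shows "intertwines v (a + a') (b + b') (c + c') (d + d')"
proof -
  have "(x + x') * y + (z + z') * w = (x * y + z * w) + (x' * y + z' * w)" for x x' y z z' w :: 'a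
    by (simp add: algebra_simps)
  then show ?thesis
    using assms unfolding intertwines_def s_add by metis
qed

lemma intertwines_one: "intertwines v 1 0 0 1"
  by (simp add: intertwines_def)

lemma no_arc_points_symp:
  assumes "arc_pts_on h (perp v) = {}" and "u \<noteq> 0 \<or> w \<noteq> 0"
  shows "symp_form v (arcv u w) \<noteq> 0"
proof
  assume "symp_form v (arcv u w) = 0"
  then have "pt (arcv u w) \<subseteq> perp v"
    by (simp add: pt_subset_perp)
  moreover have "pt (arcv u w) \<in> arc h"
    unfolding arc_eq using assms(2) by blast
  ultimately show False
    using assms(1) by (simp add: arc_pts_on_def)
qed

text \<open>If the matrix of \<open>v\<close> were singular, its first row
  \<open>(v $ 1, v $ 2)\<close> would be the parameters of an arc point on the plane.\<close>

lemma no_arc_points_qform: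
  assumes "arc_pts_on h (perp v) = {}"
  shows "qform v \<noteq> 0"
proof
  assume 0: "qform v = 0"
  have v1: "v $ 1 \<noteq> 0"
    using no_arc_points_symp[OF assms, of 0 1] by (simp add: symp_form_def arcv_nth)
  have "symp_form v (arcv (v $ 1) (v $ 2)) = s (v $ 1) * qform v"
    by (simp add: symp_form_def arcv_nth qform_def algebra_simps)
  then show False
    using no_arc_points_symp[OF assms, of "v $ 1" "v $ 2"] v1 0 by simp
qed

text \<open>Determinants of both sides give \<open>s ?D = ?D\<close>, as \<open>qform v\<close>
  cancels. If \<open>?D = 0\<close>, the form vanishes at the arc vectors whose parameters are the
  reversed rows of the matrix, so both rows are zero.\<close>

lemma intertwines_det:
  assumes tw: "intertwines v a b c d" and none: "arc_pts_on h (perp v) = {}"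
    and nz: "\<not> (a = 0 \<and> b = 0 \<and> c = 0 \<and> d = 0)"
  shows "a * d + b * c = 1"
proof -
  let ?D = "a * d + b * c"
  have "s ?D * qform v = (s a * v $ 1 + s b * v $ 3) * (s c * v $ 2 + s d * v $ 4)
      + (s a * v $ 2 + s b * v $ 4) * (s c * v $ 1 + s d * v $ 3)"
    by (simp add: qform_def s_add s_mult algebra_simps)
  also have "\<dots> = (d * v $ 1 + b * v $ 2) * (c * v $ 3 + a * v $ 4)
      + (c * v $ 1 + a * v $ 2) * (d * v $ 3 + b * v $ 4)"
    using tw by (simp add: intertwines_def)
  also have "\<dots> = ?D * qform v"
    by (simp add: qform_def algebra_simps)
  finally have "s ?D = ?D"
    using no_arc_points_qform[OF none] by simp
  moreover have "?D \<noteq> 0"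
  proof
    assume D: "?D = 0"
    have "symp_form v (arcv b a) =
        a * (s a * v $ 1 + s b * v $ 3) + b * (s a * v $ 2 + s b * v $ 4)"
      by (simp add: symp_form_def arcv_nth algebra_simps)
    also have "\<dots> = a * (d * v $ 1 + b * v $ 2) + b * (c * v $ 1 + a * v $ 2)"
      using tw by (simp add: intertwines_def)
    also have "\<dots> = ?D * v $ 1"
      by (simp add: algebra_simps)
    finally have ab: "a = 0 \<and> b = 0"
      using no_arc_points_symp[OF none, of b a] D by auto
    have "symp_form v (arcv d c) =
        c * (s c * v $ 1 + s d * v $ 3) + d * (s c * v $ 2 + s d * v $ 4)"
      by (simp add: symp_form_def arcv_nth algebra_simps)
    also have "\<dots> = c * (d * v $ 3 + b * v $ 4) + d * (c * v $ 3 + a * v $ 4)"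
      using tw by (simp add: intertwines_def)
    also have "\<dots> = ?D * v $ 4"
      by (simp add: algebra_simps)
    finally show False
      using no_arc_points_symp[OF none, of d c] D ab nz by auto
  qed
  ultimately show ?thesis
    using s_fixed by blast
qed

text \<open>Adding the identity gives another nonzero intertwiner, again of determinant 1, and det(g
  + 1) = det g + tr g + 1.\<close>

lemma intertwines_trace:
  assumes "intertwines v a b c d" and "arc_pts_on h (perp v) = {}"
    and "\<not> (a = 0 \<and> b = 0 \<and> c = 0 \<and> d = 0)" and "\<not> (a = 1 \<and> b = 0 \<and> c = 0 \<and> d = 1)"
  shows "a + d = 1"
proof -
  have "\<not> (a + 1 = 0 \<and> b + 0 = 0 \<and> c + 0 = 0 \<and> d + 1 = 0)"
    using assms(4) by (simp add: add_eq_0_iff_eq)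
  then have "(a + 1) * (d + 1) + (b + 0) * (c + 0) = 1"
    using intertwines_det[OF intertwines_add[OF assms(1) intertwines_one] assms(2)] by blast
  moreover have "(a + 1) * (d + 1) + (b + 0) * (c + 0) = (a * d + b * c) + (a + d + 1)"
    by (simp add: algebra_simps)
  ultimately have "1 + (a + d + 1) = 1"
    using intertwines_det[OF assms(1-3)] by simp
  then show ?thesis
    by (simp add: add_eq_0_iff_eq)
qed

definition SL2 :: "('a \<times> 'a \<times> 'a \<times> 'a) set" where
  "SL2 = {(a, b, c, d). a * d + b * c = 1}"

text \<open>Two elements of the stabiliser other than 1 have trace 1, so their sum has trace 0
  and must be 0 or 1.\<close>

lemma card_stabiliser_le:
  assumes none: "arc_pts_on h (perp v) = {}"
  shows "card {(a, b, c, d). a * d + b * c = 1 \<and> gmat a b c d *v v = v} \<le> 3"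
proof -
  let ?S = "{(a, b, c, d). a * d + b * c = 1 \<and> gmat a b c d *v v = v}"
  have nonzero: "\<not> (a = 0 \<and> b = 0 \<and> c = 0 \<and> d = 0)" if "a * d + b * c = 1" for a b c d :: 'a
    using that by auto
  show ?thesis
  proof (cases "?S \<subseteq> {(1, 0, 0, 1)}")
    case True
    then have "card ?S \<le> card {(1::'a, 0::'a, 0::'a, 1::'a)}"
      by (intro card_mono) auto
    then show ?thesis
      by simp
  next
    case False
    then obtain a b c d where g: "a * d + b * c = 1" "gmat a b c d *v v = v"
        and ne: "\<not> (a = 1 \<and> b = 0 \<and> c = 0 \<and> d = 1)"
      by auto
    note tw = intertwines_gmat_fixed[OF g]
    have tr: "a + d = 1"
      using intertwines_trace[OF tw none nonzero[OF g(1)] ne] .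
    \<comment> \<open>For a fixed \<open>g\<close> other than 1, the last candidate is
      \<open>g + 1\<close>.\<close>
    have "?S \<subseteq> {(1, 0, 0, 1), (a, b, c, d), (a + 1, b, c, d + 1)}"
    proof
      fix x assume "x \<in> ?S"
      then obtain a' b' c' d' where x: "x = (a', b', c', d')"
          and g': "a' * d' + b' * c' = 1" "gmat a' b' c' d' *v v = v"
        by auto
      show "x \<in> {(1, 0, 0, 1), (a, b, c, d), (a + 1, b, c, d + 1)}"
      proof (rule ccontr)
        assume "x \<notin> {(1, 0, 0, 1), (a, b, c, d), (a + 1, b, c, d + 1)}"
        then have ne': "\<not> (a' = 1 \<and> b' = 0 \<and> c' = 0 \<and> d' = 1)"
          and n0: "\<not> (a + a' = 0 \<and> b + b' = 0 \<and> c + c' = 0 \<and> d + d' = 0)"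
          and n1: "\<not> (a + a' = 1 \<and> b + b' = 0 \<and> c + c' = 0 \<and> d + d' = 1)"
          by (auto simp: x add_eq_iff)
        note tw' = intertwines_gmat_fixed[OF g']
        have tr': "a' + d' = 1"
          using intertwines_trace[OF tw' none nonzero[OF g'(1)] ne'] .
        have "(a + d) + (a' + d') = 1"
          using intertwines_trace[OF intertwines_add[OF tw tw'] none n0 n1] by (simp add: ac_simps)
        then show False
          by (simp add: tr tr')
      qed
    qed
    then have "card ?S \<le> card {(1, 0, 0, 1), (a, b, c, d), (a + 1, b, c, d + 1)}"
      by (intro card_mono) auto
    also have "\<dots> \<le> 3"
      by (simp add: card_insert_if)
    finally show ?thesis .
  qed
qed

text \<open>Shows that fixing the plane amounts to fixing the vector: the invariant determinant is
  nonzero and scales by \<open>k\<^sup>2\<close>, so \<open>k = 1\<close>.\<close>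

lemma perp_gmat_eq_imp:
  assumes g: "a * d + b * c = 1" and g': "a' * d' + b' * c' = 1"
    and none: "arc_pts_on h (perp v) = {}"
    and eq: "perp (gmat a b c d *v v) = perp (gmat a' b' c' d' *v v)"
  shows "gmat a b c d *v v = gmat a' b' c' d' *v v"
proof -
  have q: "qform v \<noteq> 0"
    using none by (rule no_arc_points_qform)
  have nonzero: "gmat a b c d *v v \<noteq> 0" "gmat a' b' c' d' *v v \<noteq> 0"
    using qform_gmat[OF g, of v] qform_gmat[OF g', of v] q by (auto simp: qform_def)
  obtain k where k: "gmat a' b' c' d' *v v = k *s (gmat a b c d *v v)"
    using perp_eq_iff[OF nonzero] eq by blast
  have scale: "qform (k *s x) = k\<^sup>2 * qform x" for x
    by (simp add: qform_def power2_eq_square algebra_simps)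
  have "k\<^sup>2 * qform v = qform v"
    using arg_cong[OF k, of qform] by (simp only: scale qform_gmat[OF g] qform_gmat[OF g'])
  then have "k\<^sup>2 = 1"
    using q by simp
  then have "(k + 1)\<^sup>2 = 0"
    by (simp add: power2_eq_square algebra_simps)
  then have "k = 1"
    by (simp add: add_eq_0_iff_eq)
  then show ?thesis
    using k by simp
qed

text \<open>For \<open>a \<noteq> 0\<close> the entry \<open>d\<close> is determined by the rest;
  for \<open>a = 0\<close> the entry \<open>c\<close> is \<open>1 / b\<close> and \<open>d\<close>
  is free.\<close>

lemma card_SL2: "card SL2 = (CARD('a) + 1) * CARD('a) * (CARD('a) - 1)"
proof -
  let ?f = "\<lambda>(a, b, c). (a, b, c, (1 + b * c) / a)" and ?g = "\<lambda>(b, d). (0 :: 'a, b, 1 / b, d)"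
  let ?A = "(UNIV - {0::'a}) \<times> (UNIV :: 'a set) \<times> (UNIV :: 'a set)"
    and ?B = "(UNIV - {0::'a}) \<times> (UNIV :: 'a set)"
  have "SL2 = ?f ` ?A \<union> ?g ` ?B"
  proof (intro equalityI subsetI)
    fix x assume "x \<in> SL2"
    then obtain a b c d where x: "x = (a, b, c, d)" and det: "a * d + b * c = 1"
      by (auto simp: SL2_def)
    show "x \<in> ?f ` ?A \<union> ?g ` ?B"
    proof (cases "a = 0")
      case True
      then have "b \<noteq> 0" "c = 1 / b"
        using det by (auto simp: eq_divide_eq mult.commute)
      then show ?thesis
        using True by (auto simp: x intro!: image_eqI[of _ ?g "(b, d)"])
    next
      case False
      have "a * d = 1 + b * c"
        using det by (metis add.commute double_left)
      then have "d = (1 + b * c) / a"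
        using False by (simp add: field_simps)
      then show ?thesis
        using False by (auto simp: x intro!: image_eqI[of _ ?f "(a, b, c)"])
    qed
  next
    fix x assume "x \<in> ?f ` ?A \<union> ?g ` ?B"
    then show "x \<in> SL2"
      by (auto simp: SL2_def add.assoc split: if_split_asm)
  qed
  moreover have "card (?f ` ?A \<union> ?g ` ?B) = card (?f ` ?A) + card (?g ` ?B)"
    by (rule card_Un_disjoint) auto
  moreover have "card (?f ` ?A) = card ?A" "card (?g ` ?B) = card ?B"
    by (intro card_image inj_onI; auto)+
  moreover have "card ?A = (CARD('a) - 1) * CARD('a) * CARD('a)" "card ?B = (CARD('a) - 1) * CARD('a)"
    by (simp_all add: card_cartesian_product card_Diff_subset)
  ultimately show ?thesis
    by (simp add: algebra_simps)
qed

lemma plane_class_0_transitive: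
  assumes "\<pi> \<in> plane_class 0" and "\<rho> \<in> plane_class 0"
  shows "arc_equiv h \<pi> \<rho>"
proof -
  obtain v where v: "v \<noteq> 0" "\<pi> = perp v"
    using assms(1) plane_obtain by (auto simp: plane_class_def)
  have none: "arc_pts_on h (perp v) = {}"
    using assms(1) v(2) by (simp add: plane_class_def)
  have \<pi>: "\<pi> \<in> pg_planes"
    using assms(1) by (simp add: plane_class_def)
  let ?\<phi> = "\<lambda>(a, b, c, d). perp (gmat a b c d *v v)"
  have equiv: "arc_equiv h \<pi> \<sigma>" if "\<sigma> \<in> ?\<phi> ` SL2" for \<sigma>
    using that equiv_gmat by (auto simp: SL2_def v(2))
  have sub: "?\<phi> ` SL2 \<subseteq> plane_class 0"
  proof
    fix \<sigma> assume "\<sigma> \<in> ?\<phi> ` SL2"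
    then show "\<sigma> \<in> plane_class 0"
      using equiv_plane_class[OF equiv \<pi>] assms(1) by blast
  qed
  have "card SL2 \<le> 3 * card (?\<phi> ` SL2)"
  proof (rule card_le_fibres)
    fix y assume "y \<in> ?\<phi> ` SL2"
    then obtain a b c d where g: "a * d + b * c = 1" and y: "y = perp (gmat a b c d *v v)"
      by (auto simp: SL2_def)
    let ?S = "{(a, b, c, d). a * d + b * c = 1 \<and> gmat a b c d *v v = v}"
    \<comment> \<open>Left multiplication by the inverse of \<open>g\<close>, which carries the
      fibre through \<open>g\<close> into the stabiliser.\<close>
    let ?left = "\<lambda>(a', b', c', d'). (d * a' + b * c', d * b' + b * d', c * a' + a * c', c * b' + a * d')"
    have "card {x \<in> SL2. ?\<phi> x = y} \<le> card ?S"
    proof (rule card_inj_on_le[of ?left])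
      have inverse: "a * (d * x + b * z) + b * (c * x + a * z) = x"
        "c * (d * x + b * z) + d * (c * x + a * z) = z" for x z
      proof -
        have "a * (d * x + b * z) + b * (c * x + a * z) = (a * d + b * c) * x"
          "c * (d * x + b * z) + d * (c * x + a * z) = (a * d + b * c) * z"
          by (simp_all add: algebra_simps)
        then show "a * (d * x + b * z) + b * (c * x + a * z) = x"
          "c * (d * x + b * z) + d * (c * x + a * z) = z"
          by (simp_all add: g)
      qed
      show "inj_on ?left {x \<in> SL2. ?\<phi> x = y}"
        by (rule inj_onI) (clarsimp, metis inverse)
      show "?left ` {x \<in> SL2. ?\<phi> x = y} \<subseteq> ?S"
      proof (rule image_subsetI)
        fix x assume "x \<in> {x \<in> SL2. ?\<phi> x = y}"
        then obtain a' b' c' d' where x: "x = (a', b', c', d')"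
            and g': "a' * d' + b' * c' = 1" and y': "perp (gmat a' b' c' d' *v v) = y"
          by (cases x) (auto simp: SL2_def)
        have "gmat a' b' c' d' *v v = gmat a b c d *v v"
          using perp_gmat_eq_imp[OF g' g none] y y' by simp
        then have "gmat d b c a *v (gmat a' b' c' d' *v v) = v"
          by (simp add: gmat_inverse[OF g])
        moreover have "(d * a' + b * c') * (c * b' + a * d') + (d * b' + b * d') * (c * a' + a * c') =
            (a * d + b * c) * (a' * d' + b' * c')"
          by (simp add: algebra_simps)
        ultimately show "?left x \<in> ?S"
          by (simp add: x g g' gmat_mult)
      qed
    qed simp
    then show "card {x \<in> SL2. ?\<phi> x = y} \<le> 3"
      using card_stabiliser_le[OF none] by simp
  qed simp
  \<comment> \<open>The order of \<open>SL2\<close> is exactly three times the size of the class, so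
    the orbit fills the class.\<close>
  then have "card (plane_class 0) \<le> card (?\<phi> ` SL2)"
    using card_SL2 card_plane_class_0 by simp
  then have "?\<phi> ` SL2 = plane_class 0"
    using sub by (intro card_seteq) auto
  then have "\<rho> \<in> ?\<phi> ` SL2"
    using assms(2) by (simp only:)
  then show ?thesis
    by (rule equiv)
qed

section \<open>The orbits\<close>

text \<open>The polarity reverses incidence: \<open>pt v\<close> lies on \<open>polar P\<close>
  exactly if \<open>P\<close> lies on \<open>perp v\<close>. Osculating planes through a point thus
  correspond to arc points on its polar.\<close>

lemma polar_osc_class: "polar ` osc_class h k = plane_class k"
proof -
  have osc: "card {\<pi> \<in> osculating_planes h. pt v \<subseteq> \<pi>} = card (arc_pts_on h (perp v))" for v :: "'a ^ 4"
  proof -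
    have "pt v \<subseteq> polar P \<longleftrightarrow> P \<subseteq> perp v" if P: "P \<in> arc h"
      for P :: "('a ^ 4) set"
    proof -
      obtain u w where "P = pt (arcv u w)"
        using P unfolding arc_eq by blast
      then show ?thesis
        by (simp add: polar_pt_perp pt_subset_perp symp_commute)
    qed
    then have "{\<pi> \<in> osculating_planes h. pt v \<subseteq> \<pi>} = polar ` arc_pts_on h (perp v)"
      unfolding osculating_planes_def arc_pts_on_def by blast
    moreover have "inj_on polar (arc_pts_on h (perp v))"
      using inj_on_polar_arc by (rule inj_on_subset) (auto simp: arc_pts_on_def)
    ultimately show ?thesis
      by (simp add: card_image)
  qed
  have arc: "pt v \<in> arc h \<longleftrightarrow> perp v \<in> osculating_planes h" if "v \<noteq> 0" for v :: "'a ^ 4"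
  proof -
    have "pt v = pt (arcv u w) \<longleftrightarrow> perp v = perp (arcv u w)" if "u \<noteq> 0 \<or> w \<noteq> 0" for u w
      using pt_eq_iff_perp[OF \<open>v \<noteq> 0\<close>, of "arcv u w"] that by auto
    then show ?thesis
      unfolding arc_eq osculating_eq by blast
  qed
  have "osc_class h k = pt ` {v. v \<noteq> 0 \<and> pt v \<notin> arc h \<and>
      card {\<pi> \<in> osculating_planes h. pt v \<subseteq> \<pi>} = k}"
    unfolding osc_class_def points_eq by blast
  also have "\<dots> = pt ` {v. v \<noteq> 0 \<and> perp v \<in> plane_class k}"
    unfolding osc by (rule arg_cong[where f = "(`) pt"], rule Collect_cong)
      (use arc perp_in_planes in \<open>auto simp: plane_class_def\<close>)
  finally have "polar ` osc_class h k = polar ` pt ` {v. v \<noteq> 0 \<and> perp v \<in> plane_class k}"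
    by (rule arg_cong)
  then have "polar ` osc_class h k = perp ` {v. v \<noteq> 0 \<and> perp v \<in> plane_class k}"
    by (simp only: image_image polar_pt_perp)
  also have "\<dots> = plane_class k"
  proof
    show "plane_class k \<subseteq> perp ` {v. v \<noteq> 0 \<and> perp v \<in> plane_class k}"
    proof
      fix \<pi> assume \<pi>: "\<pi> \<in> plane_class k"
      then have "\<pi> \<in> pg_planes"
        by (simp add: plane_class_def)
      then obtain v where "v \<noteq> 0" "\<pi> = perp v"
        by (rule plane_obtain)
      then show "\<pi> \<in> perp ` {v. v \<noteq> 0 \<and> perp v \<in> plane_class k}"
        using \<pi> by blast
    qed
  qed blast
  finally show ?thesis .
qed

lemma orbit_eq:
  assumes "C \<subseteq> (pg_planes :: ('a ^ 4) set set)"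
    and "\<And>\<pi> \<rho>. \<pi> \<in> C \<Longrightarrow> \<rho> \<in> C \<Longrightarrow> arc_equiv h \<pi> \<rho>"
    and "\<And>\<pi> \<rho>. \<pi> \<in> C \<Longrightarrow> arc_equiv h \<pi> \<rho> \<Longrightarrow> \<rho> \<in> C"
    and "\<pi> \<in> C"
  shows "orbit (arc_group h) (\<lambda>g. g) \<pi> = C"
  using assms orbit_arc_group[of \<pi> h] by blast

lemma orbit_plane_class:
  assumes "k \<in> {0, 1, 2, 3}" and "\<pi> \<in> plane_class k"
  shows "orbit (arc_group h) (\<lambda>g. g) \<pi> = plane_class k"
proof (rule orbit_eq[OF _ _ _ assms(2)])
  show "plane_class k \<subseteq> pg_planes"
    by (auto simp: plane_class_def)
  then show "\<rho> \<in> plane_class k" if "\<pi> \<in> plane_class k" "arc_equiv h \<pi> \<rho>" for \<pi> \<rho>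
    using that equiv_plane_class by blast
qed (use plane_class_transitive[of k] plane_class_0_transitive assms(1) in blast)

lemma orbit_osculating:
  assumes "\<pi> \<in> osculating_planes h"
  shows "orbit (arc_group h) (\<lambda>g. g) \<pi> = (osculating_planes h :: ('a ^ 4) set set)"
proof (rule orbit_eq[OF osculating_subset_planes osculating_transitive _ assms])
  show "\<rho> \<in> osculating_planes h" if "\<pi> \<in> osculating_planes h" "arc_equiv h \<pi> \<rho>"
    for \<pi> \<rho> :: "('a ^ 4) set"
    using that equiv_osculating osculating_subset_planes by blast
qed

lemma plane_class_nonempty:
  assumes "k \<in> {0, 1, 2, 3}"
  shows "plane_class k \<noteq> {}"
  using assms card_plane_class card_plane_class_0 card_gt_2 by auto

lemma plane_class_disjoint: "\<pi> \<in> plane_class k \<Longrightarrow> \<pi> \<in> plane_class l \<Longrightarrow> k = l"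
  by (simp add: plane_class_def)

lemma osculating_nonempty: "osculating_planes h \<noteq> ({} :: ('a ^ 4) set set)"
  by (rule notI) (use card_osculating in simp)

lemma orbits_planes:
  "orbits (arc_group h) (pg_planes :: ('a ^ 4) set set) (\<lambda>g. g) =
     {osculating_planes h, plane_class 0, plane_class 1, plane_class 2, plane_class 3}"
proof -
  have orbits: "orbits (arc_group h) (pg_planes :: ('a ^ 4) set set) (\<lambda>g. g) =
      (\<lambda>\<pi>. orbit (arc_group h) (\<lambda>g. g) \<pi>) ` pg_planes"
    by (auto simp: orbits_def)
  have osc: "orbit (arc_group h) (\<lambda>g. g) ` osculating_planes h =
      {osculating_planes h :: ('a ^ 4) set set}"
    using orbit_osculating osculating_nonempty by (auto simp: image_iff)
  have classes: "orbit (arc_group h) (\<lambda>g. g) ` plane_class k = {plane_class k}" if "k \<in> {0, 1, 2, 3}" for k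
    using orbit_plane_class[OF that] plane_class_nonempty[OF that] by auto
  then show ?thesis
    unfolding orbits unfolding planes_eq image_Un osc
    by (simp add: classes Un_insert_left insert_commute del: One_nat_def)
qed

lemma card_orbits_planes:
  "card (orbits (arc_group h) (pg_planes :: ('a ^ 4) set set) (\<lambda>g. g)) = 5"
proof -
  have "plane_class k \<noteq> plane_class l" if "k \<in> {0, 1, 2, 3}" "k \<noteq> l" for k l
    using plane_class_nonempty[OF that(1)] plane_class_disjoint that(2) by blast
  moreover have "osculating_planes h \<noteq> plane_class k" for k
    using osculating_nonempty by (auto simp: plane_class_def)
  ultimately show ?thesis
    unfolding orbits_planes by simp
qed

lemma plane_class_0_eq: "plane_class 0 = {\<pi> \<in> pg_planes. arc_pts_on h \<pi> = {}}"
  using osculating_arc_pts_nonempty by (auto simp: plane_class_def)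

lemma plane_class_eq: "k \<noteq> 1 \<Longrightarrow> plane_class k = {\<pi> \<in> pg_planes. card (arc_pts_on h \<pi>) = k}"
  using osculating_one_point by (auto simp: plane_class_def)

end

theorem proposition3p4:
  fixes q n h :: nat
  assumes "q = 2 ^ n" and "n \<ge> 3" and "h > 0" and "gcd n h = 1"
    and "CARD('a::{field,finite}) = q"
  shows
    "orbits (arc_group h) (pg_planes :: ('a ^ 4) set set) (\<lambda>g. g) =
       {osculating_planes h, polar ` osc_class h 0, polar ` osc_class h 1,
        polar ` osc_class h 2, polar ` osc_class h 3}
     \<and> card (orbits (arc_group h) (pg_planes :: ('a ^ 4) set set) (\<lambda>g. g)) = 5
     \<and> card (osculating_planes h :: ('a ^ 4) set set) = q + 1
     \<and> real (card (polar ` osc_class h 0 :: ('a ^ 4) set set)) = (real q ^ 3 - real q) / 3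
     \<and> (polar ` osc_class h 0 :: ('a ^ 4) set set) =
         {\<pi> \<in> pg_planes. arc_pts_on h \<pi> = {}}
     \<and> real (card (polar ` osc_class h 1 :: ('a ^ 4) set set)) = (real q ^ 3 - real q) / 2
     \<and> (polar ` osc_class h 1 :: ('a ^ 4) set set) =
         {\<pi> \<in> pg_planes - osculating_planes h. card (arc_pts_on h \<pi>) = 1}
     \<and> card (polar ` osc_class h 2 :: ('a ^ 4) set set) = q ^ 2 + q
     \<and> (polar ` osc_class h 2 :: ('a ^ 4) set set) =
         {\<pi> \<in> pg_planes. card (arc_pts_on h \<pi>) = 2}
     \<and> real (card (polar ` osc_class h 3 :: ('a ^ 4) set set)) = (real q ^ 3 - real q) / 6
     \<and> (polar ` osc_class h 3 :: ('a ^ 4) set set) =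
         {\<pi> \<in> pg_planes. card (arc_pts_on h \<pi>) = 3}"
proof -
  have "2 ^ 3 \<le> (2 ^ n :: nat)"
    using assms(2) by (rule power_increasing) simp
  then have q: "q \<ge> 8"
    using assms(1) by simp
  interpret twisted_arc h "\<lambda>x::'a. x ^ (2 ^ h)"
  proof
    show "CHAR('a) = 2"
      using assms(1,5) field_char_2 by metis
    show "x = 0 \<or> x = 1" if "x ^ (2 ^ h) = x" for x :: 'a
      using frobenius_power_fixed[of n h x] assms that by simp
    show "CARD('a) > 2"
      using q assms(5) by simp
  qed simp
  have cube: "real ((q + 1) * q * (q - 1)) = real q ^ 3 - real q"
    using q by (simp add: of_nat_diff eval_nat_numeral algebra_simps)
  \<comment> \<open>The sizes are known as multiples of natural numbers; the passage to real
    quotients takes place here.\<close>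
  have div: "real c = (real q ^ 3 - real q) / real m" if "m * c = (q + 1) * q * (q - 1)" "m > 0" for m c
    using cube that by (simp add: field_simps flip: of_nat_mult)
  have "real (card (plane_class 0)) = (real q ^ 3 - real q) / 3"
    using div[of 3] card_plane_class_0 unfolding assms(5) by simp
  moreover have "real (card (plane_class 1)) = (real q ^ 3 - real q) / 2"
    using div[of 2] card_plane_class(1) unfolding assms(5) by simp
  moreover have "real (card (plane_class 3)) = (real q ^ 3 - real q) / 6"
    using div[of 6] card_plane_class(3) unfolding assms(5) by simp
  moreover have "card (plane_class 2) = q ^ 2 + q"
    using card_plane_class(2) unfolding assms(5) by (simp add: power2_eq_square)
  ultimately show ?thesis
    unfolding polar_osc_class
    using orbits_planes card_orbits_planes card_osculating assms(5) plane_class_0_eq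
      plane_class_eq[of 2] plane_class_eq[of 3]
    by (simp add: plane_class_def[of "Suc 0"])
qed

end
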